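(* The operator $\mathcal J:C(P)\to C(P)$ is a linear bijection (a linear automorphism of $C(P)$).
   Context: Let $R$ be an irreducible reduced crystallographic root system of rank $n$ spanning a real Euclidean space $V$; $\alpha^\vee:=2\alpha/\langle\alpha,\alpha\rangle$; $P$ the weight lattice; $R^+$ positive roots with simple roots $\alpha_1,\dots,\alpha_n$; $P^+$ the dominant weights; $A:=\{x:0<\langle x,\alpha^\vee\rangle<1\ \forall\alpha\in R^+\}$. $W_0$ finite Weyl group, $W$ extended affine Weyl group generated by $W_0$ and translations $t_\lambda$ ($\lambda\in P$); $s_j$ reflection in $\{\langle x,\alpha_j^\vee\rangle=0\}$; $\ell(w)$ = number of hyperplanes $\{\langle x,\alpha^\vee\rangle=k\}$ separating $A$ and $wA$. $w_\lambda$ = shortest element of $W_0$ with $w_\lambda\lambda\in P^+$, $\lambda_+:=w_\lambda\lambda$. $q:W\to\mathbb R\setminus\{0\}$ length multiplicative, $q_j:=q_{s_j}$. $\mathcal H_0$: finite Hecke algebra with basis $T_w$ ($w\in W_0$), $(T_j-q_j)(T_j+q_j^{-1})=0$, $T_{ww'}=T_wT_{w'}$ if lengths add. $C(P)$: functions $P\to\mathbb C$, $(wf)(\lambda)=f(w^{-1}\lambda)$. $I(\cdot)$ is the representation of $\mathcal H_0$ on $C(P)$ with $T_j\mapsto I_j:=q_js_j+(q_j-q_j^{-1})J_j$, where for $m:=\langle\lambda,\alpha_j^\vee\rangle$: $(J_jf)(\lambda)=-\sum_{k=1}^{m}f(\lambda-k\alpha_j)$ if $m>0$, $0$ if $m=0$,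 $\sum_{k=0}^{-m-1}f(\lambda+k\alpha_j)$ if $m<0$. $\mathcal J:C(P)\to C(P)$ is $(\mathcal Jf)(\lambda):=q_{t_\lambda}q_{w_\lambda}\big(I(T_{w_\lambda^{-1}})^{-1}f\big)(\lambda_+)$. *)

theory Defs
  imports "HOL-Analysis.Analysis"
begin

definition coroot :: "'a::euclidean_space \<Rightarrow> 'a" where
  "coroot \<alpha> = (2 / (\<alpha> \<bullet> \<alpha>)) *\<^sub>R \<alpha>"

definition refl :: "'a::euclidean_space \<Rightarrow> 'a \<Rightarrow> 'a" where
  "refl \<alpha> x = x - (x \<bullet> coroot \<alpha>) *\<^sub>R \<alpha>"

definition root_system :: "'a::euclidean_space set \<Rightarrow> bool" where
  "root_system R \<longleftrightarrow> finite R \<and> 0 \<notin> R \<and> span R = UNIV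
     \<and> (\<forall>\<alpha>\<in>R. refl \<alpha> ` R = R)
     \<and> (\<forall>\<alpha>\<in>R. \<forall>\<beta>\<in>R. \<beta> \<bullet> coroot \<alpha> \<in> \<int>)"

definition reduced_rs :: "'a::euclidean_space set \<Rightarrow> bool" where
  "reduced_rs R \<longleftrightarrow> (\<forall>\<alpha>\<in>R. \<forall>c::real. c *\<^sub>R \<alpha> \<in> R \<longrightarrow> c = 1 \<or> c = -1)"

definition irreducible_rs :: "'a::euclidean_space set \<Rightarrow> bool" where
  "irreducible_rs R \<longleftrightarrow> \<not> (\<exists>R1 R2. R1 \<noteq> {} \<and> R2 \<noteq> {} \<and> R1 \<union> R2 = R
       \<and> (\<forall>a\<in>R1. \<forall>b\<in>R2. a \<bullet> b = 0))"

text \<open>A positive system is given by a regular vector z.\<close>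
definition regular :: "'a::euclidean_space set \<Rightarrow> 'a \<Rightarrow> bool" where
  "regular R z \<longleftrightarrow> (\<forall>\<alpha>\<in>R. \<alpha> \<bullet> z \<noteq> 0)"

definition pos_roots :: "'a::euclidean_space set \<Rightarrow> 'a \<Rightarrow> 'a set" where
  "pos_roots R z = {\<alpha>\<in>R. \<alpha> \<bullet> z > 0}"

definition simple_roots :: "'a::euclidean_space set \<Rightarrow> 'a \<Rightarrow> 'a set" where
  "simple_roots R z = {\<alpha>\<in>pos_roots R z.
      \<not> (\<exists>\<beta>\<in>pos_roots R z. \<exists>\<gamma>\<in>pos_roots R z. \<alpha> = \<beta> + \<gamma>)}"

definition weights :: "'a::euclidean_space set \<Rightarrow> 'a set" where
  "weights R = {lam. \<forall>\<alpha>\<in>R. lam \<bullet> coroot \<alpha> \<in> \<int>}"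

definition dominant :: "'a::euclidean_space set \<Rightarrow> 'a \<Rightarrow> 'a set" where
  "dominant R z = {lam\<in>weights R. \<forall>\<alpha>\<in>simple_roots R z. lam \<bullet> coroot \<alpha> \<ge> 0}"

definition alcove :: "'a::euclidean_space set \<Rightarrow> 'a \<Rightarrow> 'a set" where
  "alcove R z = {x. \<forall>\<alpha>\<in>pos_roots R z. 0 < x \<bullet> coroot \<alpha> \<and> x \<bullet> coroot \<alpha> < 1}"

inductive_set W0 :: "'a::euclidean_space set \<Rightarrow> ('a \<Rightarrow> 'a) set" for R where
  W0_id: "id \<in> W0 R"
| W0_step: "w \<in> W0 R \<Longrightarrow> \<alpha> \<in> R \<Longrightarrow> refl \<alpha> \<circ> w \<in> W0 R"

definition transl :: "'a::euclidean_space \<Rightarrow> 'a \<Rightarrow> 'a" where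
  "transl \<mu> = (\<lambda>x. x + \<mu>)"

definition Waff :: "'a::euclidean_space set \<Rightarrow> ('a \<Rightarrow> 'a) set" where
  "Waff R = {transl \<mu> \<circ> w | w \<mu>. w \<in> W0 R \<and> \<mu> \<in> weights R}"

definition separates :: "'a::euclidean_space \<Rightarrow> real \<Rightarrow> 'a set \<Rightarrow> 'a set \<Rightarrow> bool" where
  "separates \<alpha> k X Y \<longleftrightarrow>
     ((\<forall>x\<in>X. x \<bullet> coroot \<alpha> < k) \<and> (\<forall>y\<in>Y. y \<bullet> coroot \<alpha> > k))
   \<or> ((\<forall>x\<in>X. x \<bullet> coroot \<alpha> > k) \<and> (\<forall>y\<in>Y. y \<bullet> coroot \<alpha> < k))"

definition len :: "'a::euclidean_space set \<Rightarrow> 'a \<Rightarrow> ('a \<Rightarrow> 'a) \<Rightarrow> nat" where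
  "len R z w = card {H. \<exists>\<alpha>\<in>R. \<exists>k::int. H = {x. x \<bullet> coroot \<alpha> = of_int k}
        \<and> separates \<alpha> (of_int k) (alcove R z) (w ` alcove R z)}"

definition length_mult :: "'a::euclidean_space set \<Rightarrow> 'a \<Rightarrow> (('a \<Rightarrow> 'a) \<Rightarrow> real) \<Rightarrow> bool" where
  "length_mult R z q \<longleftrightarrow> (\<forall>w\<in>Waff R. q w \<noteq> 0)
     \<and> (\<forall>w\<in>Waff R. \<forall>w'\<in>Waff R. len R z (w \<circ> w') = len R z w + len R z w'
            \<longrightarrow> q (w \<circ> w') = q w * q w')"

definition wmin :: "'a::euclidean_space set \<Rightarrow> 'a \<Rightarrow> 'a \<Rightarrow> ('a \<Rightarrow> 'a)" where
  "wmin R z lam = (THE w. w \<in> W0 R \<and> w lam \<in> dominant R z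
       \<and> (\<forall>v\<in>W0 R. v lam \<in> dominant R z \<longrightarrow> len R z w \<le> len R z v))"

text \<open>C(P): complex functions on P, realised as functions on V vanishing off P.\<close>
definition CP :: "'a::euclidean_space set \<Rightarrow> ('a \<Rightarrow> complex) set" where
  "CP R = {f. \<forall>x. x \<notin> weights R \<longrightarrow> f x = 0}"

definition Jop :: "'a::euclidean_space set \<Rightarrow> 'a \<Rightarrow> ('a \<Rightarrow> complex) \<Rightarrow> 'a \<Rightarrow> complex" where
  "Jop R \<alpha> f lam = (if lam \<in> weights R then
      (let m = \<lfloor>lam \<bullet> coroot \<alpha>\<rfloor> in
        if m > 0 then - (\<Sum>k\<in>{1..m}. f (lam - of_int k *\<^sub>R \<alpha>))
        else if m = 0 then 0
        else (\<Sum>k\<in>{0..-m-1}. f (lam + of_int k *\<^sub>R \<alpha>)))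
    else 0)"

text \<open>I_j = q_j s_j + (q_j - q_j^{-1}) J_j, with (s_j f)(lambda) = f(s_j^{-1} lambda) = f(s_j lambda).\<close>
definition Iop :: "'a::euclidean_space set \<Rightarrow> (('a \<Rightarrow> 'a) \<Rightarrow> real) \<Rightarrow> 'a
                   \<Rightarrow> ('a \<Rightarrow> complex) \<Rightarrow> 'a \<Rightarrow> complex" where
  "Iop R q \<alpha> f lam = (if lam \<in> weights R then
      complex_of_real (q (refl \<alpha>)) * f (refl \<alpha> lam)
      + complex_of_real (q (refl \<alpha>) - 1 / q (refl \<alpha>)) * Jop R \<alpha> f lam
    else 0)"

definition reduced_word :: "'a::euclidean_space set \<Rightarrow> 'a \<Rightarrow> ('a \<Rightarrow> 'a) \<Rightarrow> 'a list \<Rightarrow> bool" where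
  "reduced_word R z w js \<longleftrightarrow> set js \<subseteq> simple_roots R z
     \<and> w = foldr (\<circ>) (map refl js) id \<and> length js = len R z w"

definition IT :: "'a::euclidean_space set \<Rightarrow> 'a \<Rightarrow> (('a \<Rightarrow> 'a) \<Rightarrow> real) \<Rightarrow> ('a \<Rightarrow> 'a)
                  \<Rightarrow> ('a \<Rightarrow> complex) \<Rightarrow> 'a \<Rightarrow> complex" where
  "IT R z q w = foldr (\<circ>) (map (Iop R q) (SOME js. reduced_word R z w js)) id"

definition Jcal :: "'a::euclidean_space set \<Rightarrow> 'a \<Rightarrow> (('a \<Rightarrow> 'a) \<Rightarrow> real)
                    \<Rightarrow> ('a \<Rightarrow> complex) \<Rightarrow> 'a \<Rightarrow> complex" where
  "Jcal R z q f lam = (if lam \<in> weights R then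
      (let w = wmin R z lam in
        complex_of_real (q (transl lam) * q w)
        * (inv_into (CP R) (IT R z q (inv w)) f) (w lam))
    else 0)"

end

theory Submission
  imports Defs
begin

text \<open>
  The quadratic relation \<open>(I\<^sub>j - q\<^sub>j)(I\<^sub>j + 1/q\<^sub>j) = 0\<close> makes every \<open>I\<^sub>j\<close> invertible, and on a weight
  \<open>x\<close> with \<open>m = \<langle>x, \<alpha>\<^sub>j\<^sup>\<or>\<rangle> > 0\<close> the inverse takes \<open>f\<close> to \<open>f (s\<^sub>j x) / q\<^sub>j\<close> plus a combination of the
  \<open>f (x - k \<alpha>\<^sub>j)\<close> with \<open>0 \<le> k < m\<close>. Following a reduced word from the dominant weight in the orbit of
  \<open>\<lambda>\<close> down to \<open>\<lambda>\<close>, the value of \<open>Jcal f\<close> at \<open>\<lambda>\<close> is a nonzero multiple of \<open>f \<lambda>\<close> plus a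
  combination of values at weights \<open>\<mu>\<close> that are either strictly shorter than \<open>\<lambda>\<close>, or in the same orbit
  but closer to the dominant chamber (fewer positive roots \<open>\<beta>\<close> with \<open>\<langle>\<mu>, \<beta>\<rangle> < 0\<close>). This order on
  weights is well-founded because balls contain finitely many weights, so the operator is triangular
  with nonzero diagonal, hence bijective.
\<close>

section \<open>Preliminaries\<close>

text \<open>Injectivity: by well-founded induction \<open>F h = 0\<close> forces
  \<open>h x = 0\<close>, since \<open>h\<close> already vanishes below \<open>x\<close>.
  Surjectivity: \<open>f x\<close> is found by recursion along \<open>r\<close>, dividing by
  \<open>c x\<close>; linearity splits off the part of \<open>f\<close> below
  \<open>x\<close>.\<close>

lemma bij_betw_triangular:
  fixes F :: "('a \<Rightarrow> 'b::field) \<Rightarrow> 'a \<Rightarrow> 'b" and c :: "'a \<Rightarrow> 'b" and P :: "'a set"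
  defines "V \<equiv> {f. \<forall>x. x \<notin> P \<longrightarrow> f x = 0}"
  assumes wf: "wf r"
    and maps: "\<And>f. f \<in> V \<Longrightarrow> F f \<in> V"
    and lin: "\<And>f g a b. f \<in> V \<Longrightarrow> g \<in> V \<Longrightarrow>
      F (\<lambda>x. a * f x + b * g x) = (\<lambda>x. a * F f x + b * F g x)"
    and c: "\<And>x. x \<in> P \<Longrightarrow> c x \<noteq> 0"
    and tri: "\<And>x h. x \<in> P \<Longrightarrow> h \<in> V \<Longrightarrow> (\<And>y. y \<in> P \<Longrightarrow> (y, x) \<in> r \<Longrightarrow> h y = 0) \<Longrightarrow>
      F h x = c x * h x"
  shows "bij_betw F V V"
proof -
  have "f = g" if fg: "f \<in> V" "g \<in> V" "F f = F g" for f g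
  proof -
    define h where "h = (\<lambda>x. 1 * f x + (-1) * g x)"
    have hV: "h \<in> V"
      using fg by (simp add: h_def V_def)
    have F0: "F h x = 0" for x
      unfolding h_def lin[OF fg(1,2)] using fg(3) by simp
    have "h x = 0" for x
      using wf
    proof (induction x rule: wf_induct_rule)
      case (less x)
      show ?case
      proof (cases "x \<in> P")
        case True
        then show ?thesis
          using tri[OF True hV] less F0 c by force
      qed (use hV in \<open>simp add: V_def\<close>)
    qed
    then show ?thesis
      by (auto simp: h_def fun_eq_iff)
  qed
  moreover have "\<exists>f\<in>V. F f = g" if g: "g \<in> V" for g
  proof -
    \<comment> \<open>\<open>low f x\<close> keeps the values of \<open>f\<close> below
      \<open>x\<close>, all known when \<open>f x\<close> is chosen; \<open>H\<close> solves
      \<open>F f x = g x\<close> for the remaining unknown \<open>f x\<close>.\<close>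
    define low where "low f x = (\<lambda>y. if y \<in> P \<and> (y, x) \<in> r then f y else 0)"
      for f :: "'a \<Rightarrow> 'b" and x
    define H where "H f x = (if x \<in> P then (g x - F (low f x) x) / c x else 0)" for f x
    define f where "f = wfrec r H"
    have "low (cut f r x) x = low f x" for x
      by (auto simp: low_def cut_def)
    then have f: "f x = H f x" for x
      unfolding f_def by (subst wfrec[OF wf]) (simp add: H_def flip: f_def)
    have fV: "f \<in> V"
      by (simp add: V_def f H_def)
    have lowV: "low f x \<in> V" for x
      by (simp add: V_def low_def)
    have "F f x = g x" for x
    proof (cases "x \<in> P")
      case True
      \<comment> \<open>What the truncation removes from \<open>f\<close> is exactly the part below
        \<open>x\<close>, so \<open>tri\<close> applies; \<open>r\<close> is irreflexive, so the
        value at \<open>x\<close> is kept.\<close>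
      define h where "h = (\<lambda>y. 1 * f y + (-1) * low f x y)"
      have "h \<in> V"
        using fV lowV[of x] by (simp add: h_def V_def)
      then have "F h x = c x * h x"
        using tri[OF True, of h] by (simp add: h_def low_def)
      moreover have "F h x = F f x - F (low f x) x"
        unfolding h_def lin[OF fV lowV] by simp
      moreover have "h x = f x"
        using wf by (simp add: h_def low_def)
      ultimately have "F f x = c x * f x + F (low f x) x"
        by (simp add: diff_eq_eq)
      then show ?thesis
        using True c by (simp add: f[of x] H_def)
    qed (use maps[OF fV] g in \<open>simp add: V_def\<close>)
    then show ?thesis
      using fV by blast
  qed
  ultimately show ?thesis
    unfolding bij_betw_def inj_on_def using maps by blast
qed

lemma sum_int_split:
  fixes g :: "int \<Rightarrow> 'b::comm_monoid_add"
  assumes "i \<le> j"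
  shows sum_int_last: "sum g {i..j} = g j + sum g {i..j-1}"
    and sum_int_first: "sum g {i..j} = g i + sum g {i+1..j}"
proof -
  have last: "insert j {i..j-1} = {i..j}" and first: "insert i {i+1..j} = {i..j}"
    using assms by auto
  show "sum g {i..j} = g j + sum g {i..j-1}"
    unfolding last[symmetric] by (rule sum.insert) auto
  show "sum g {i..j} = g i + sum g {i+1..j}"
    unfolding first[symmetric] by (rule sum.insert) auto
qed

section \<open>Reflections\<close>

lemma inner_coroot_self: "\<alpha> \<noteq> 0 \<Longrightarrow> \<alpha> \<bullet> coroot \<alpha> = 2"
  by (simp add: coroot_def)

lemma coroot_uminus [simp]: "coroot (- \<alpha>) = - coroot \<alpha>"
  by (simp add: coroot_def)

lemma refl_uminus [simp]: "refl (- \<alpha>) = refl \<alpha>"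
  by (simp add: refl_def fun_eq_iff)

lemma inner_coroot: "x \<bullet> coroot \<alpha> = 2 * (x \<bullet> \<alpha>) / (\<alpha> \<bullet> \<alpha>)"
  by (simp add: coroot_def)

lemma coroot_pos_iff: "\<alpha> \<noteq> 0 \<Longrightarrow> x \<bullet> coroot \<alpha> > 0 \<longleftrightarrow> x \<bullet> \<alpha> > 0"
  by (simp add: inner_coroot zero_less_divide_iff not_less[THEN iffD2])

lemma coroot_neg_iff: "\<alpha> \<noteq> 0 \<Longrightarrow> x \<bullet> coroot \<alpha> < 0 \<longleftrightarrow> x \<bullet> \<alpha> < 0"
  using coroot_pos_iff[of \<alpha> "- x"] by simp

lemma linear_refl: "linear (refl \<alpha>)"
  unfolding refl_def by (intro linearI) (simp_all add: algebra_simps)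

lemma refl_self: "refl \<alpha> \<alpha> = - \<alpha>"
  by (cases "\<alpha> = 0") (simp_all add: refl_def inner_coroot_self scaleR_2)

lemma refl_refl [simp]: "refl \<alpha> (refl \<alpha> x) = x"
proof (cases "\<alpha> = 0")
  case False
  then show ?thesis
    by (simp add: refl_def inner_diff_left inner_coroot_self algebra_simps)
qed (simp add: refl_def)

lemma orthogonal_transformation_refl: "orthogonal_transformation (refl \<alpha>)"
proof -
  have "refl \<alpha> x \<bullet> refl \<alpha> y = x \<bullet> y" for x y
  proof (cases "\<alpha> = 0")
    case False
    then show ?thesis
      by (simp add: refl_def inner_coroot algebra_simps inner_commute)
  qed (simp add: refl_def)
  then show ?thesis
    by (simp add: orthogonal_transformation_def linear_refl)
qed

lemma inner_refl_left: "refl \<alpha> x \<bullet> y = x \<bullet> refl \<alpha> y"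
  using orthogonal_transformation_refl[of \<alpha>] refl_refl[of \<alpha>]
  by (metis orthogonal_transformation_def)

lemma refl_inner_self: "refl \<alpha> x \<bullet> refl \<alpha> x = x \<bullet> x"
  by (simp add: inner_refl_left)

lemma coroot_orthogonal_transformation:
  assumes "orthogonal_transformation u"
  shows "coroot (u \<alpha>) = u (coroot \<alpha>)"
  using assms by (simp add: coroot_def orthogonal_transformation_def linear_cmul)

lemma refl_orthogonal_transformation:
  assumes "orthogonal_transformation u"
  shows "refl (u \<alpha>) (u x) = u (refl \<alpha> x)"
  using assms
  by (simp add: refl_def coroot_orthogonal_transformation orthogonal_transformation_def
      linear_diff linear_cmul)

definition refl_word :: "'a::euclidean_space list \<Rightarrow> 'a \<Rightarrow> 'a" where
  "refl_word js = foldr (\<circ>) (map refl js) id"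

lemma refl_word_simps [simp]:
  "refl_word [] = id"
  "refl_word (\<alpha> # js) = refl \<alpha> \<circ> refl_word js"
  by (simp_all add: refl_word_def)

lemma refl_word_append [simp]: "refl_word (js @ ks) = refl_word js \<circ> refl_word ks"
  by (induction js) (simp_all add: o_assoc)

lemma refl_word_rev [simp]: "refl_word (rev js) (refl_word js x) = x"
  by (induction js arbitrary: x) auto

lemma refl_word_rev' [simp]: "refl_word js (refl_word (rev js) x) = x"
  using refl_word_rev[of "rev js"] by simp

lemma inv_refl_word: "inv (refl_word js) = refl_word (rev js)"
  by (rule inv_unique_comp) (simp_all add: fun_eq_iff)

lemma orthogonal_transformation_refl_word: "orthogonal_transformation (refl_word js)"
proof (induction js)
  case Nil
  then show ?case
    by (simp add: id_def)
next
  case (Cons \<alpha> js)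
  then show ?case
    unfolding refl_word_simps
    by (rule orthogonal_transformation_compose[OF orthogonal_transformation_refl])
qed

lemma linear_refl_word: "linear (refl_word js)"
  by (simp add: orthogonal_transformation_linear orthogonal_transformation_refl_word)

text \<open>The component \<open>y\<close> of \<open>v\<close> orthogonal to \<open>u\<close> lies
  in the first hyperplane, hence in the second, so it is orthogonal to itself.\<close>

lemma hyperplane_eq_imp_scaleR:
  fixes u v :: "'a::real_inner"
  assumes "{x. x \<bullet> u = 0} = {x. x \<bullet> v = 0}" "u \<noteq> 0"
  obtains c where "v = c *\<^sub>R u"
proof -
  define y where "y = v - ((v \<bullet> u) / (u \<bullet> u)) *\<^sub>R u"
  have "y \<bullet> u = 0"
    using assms(2) by (simp add: y_def algebra_simps)
  moreover from this have "y \<bullet> v = 0"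
    using assms(1) by blast
  ultimately have "y \<bullet> y = 0"
    by (subst (2) y_def) (simp add: inner_diff_right)
  then show ?thesis
    using that by (simp add: y_def)
qed

section \<open>Positive systems and the Weyl group\<close>

locale based_root_system =
  fixes R :: "'a::euclidean_space set" and z :: 'a
  assumes root_system: "root_system R" and reduced: "reduced_rs R" and regular: "regular R z"
begin

abbreviation "Pos \<equiv> pos_roots R z"
abbreviation "Sim \<equiv> simple_roots R z"
abbreviation "P \<equiv> weights R"

lemma finite_R: "finite R" and zero_notin_R: "0 \<notin> R" and span_R: "span R = UNIV"
  using root_system by (auto simp: root_system_def)

lemma refl_in_R: "\<alpha> \<in> R \<Longrightarrow> \<beta> \<in> R \<Longrightarrow> refl \<alpha> \<beta> \<in> R"
  using root_system by (auto simp: root_system_def)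

lemma root_coroot_Ints: "\<alpha> \<in> R \<Longrightarrow> \<beta> \<in> R \<Longrightarrow> \<beta> \<bullet> coroot \<alpha> \<in> \<int>"
  using root_system by (auto simp: root_system_def)

lemma uminus_in_R: "\<alpha> \<in> R \<Longrightarrow> - \<alpha> \<in> R"
  using refl_in_R[of \<alpha> \<alpha>] by (simp add: refl_self)

lemma Pos_subset: "Pos \<subseteq> R" and Sim_subset: "Sim \<subseteq> Pos"
  by (auto simp: pos_roots_def simple_roots_def)

lemma Pos_in_R: "\<beta> \<in> Pos \<Longrightarrow> \<beta> \<in> R" and Sim_in_Pos: "\<beta> \<in> Sim \<Longrightarrow> \<beta> \<in> Pos"
  using Pos_subset Sim_subset by auto

lemma Sim_in_R: "\<beta> \<in> Sim \<Longrightarrow> \<beta> \<in> R"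
  by (simp add: Pos_in_R Sim_in_Pos)

lemma finite_Pos: "finite Pos"
  using finite_R Pos_subset finite_subset by blast

lemma Pos_nonzero: "\<beta> \<in> Pos \<Longrightarrow> \<beta> \<noteq> 0"
  using Pos_in_R zero_notin_R by auto

lemma Pos_or_uminus: "\<beta> \<in> R \<Longrightarrow> \<beta> \<in> Pos \<or> - \<beta> \<in> Pos"
  using regular uminus_in_R[of \<beta>] by (force simp: pos_roots_def regular_def)

lemma not_Pos_uminus: "\<beta> \<in> Pos \<Longrightarrow> - \<beta> \<notin> Pos"
  by (auto simp: pos_roots_def)

text \<open>The product \<open>n * m\<close> of the two Cartan integers is four times a squared
  cosine, here below 4. Both are positive, so one of them is 1, and the corresponding reflection
  yields \<beta> - \<alpha> up to sign.\<close>

lemma root_diff: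
  assumes "\<alpha> \<in> Pos" "\<beta> \<in> Pos" "\<alpha> \<noteq> \<beta>" "\<beta> \<bullet> \<alpha> > 0"
  shows "\<beta> - \<alpha> \<in> R"
proof -
  have ne: "\<alpha> \<noteq> 0" "\<beta> \<noteq> 0"
    using assms Pos_nonzero by auto
  obtain n where n: "\<beta> \<bullet> coroot \<alpha> = of_int n"
    using root_coroot_Ints[of \<alpha> \<beta>] assms Pos_in_R by (auto elim: Ints_cases)
  obtain m where m: "\<alpha> \<bullet> coroot \<beta> = of_int m"
    using root_coroot_Ints[of \<beta> \<alpha>] assms Pos_in_R by (auto elim: Ints_cases)
  have "n > 0" "m > 0"
    using n m ne assms(4) coroot_pos_iff[of \<alpha> \<beta>] coroot_pos_iff[of \<beta> \<alpha>]
    by (simp_all add: inner_commute)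
  have "(\<beta> \<bullet> \<alpha>)\<^sup>2 < (\<beta> \<bullet> \<beta>) * (\<alpha> \<bullet> \<alpha>)"
  proof (rule ccontr)
    assume "\<not> ?thesis"
    then have "(\<beta> \<bullet> \<alpha>)\<^sup>2 = (\<beta> \<bullet> \<beta>) * (\<alpha> \<bullet> \<alpha>)"
      using Cauchy_Schwarz_ineq[of \<beta> \<alpha>] by simp
    \<comment> \<open>Equality in Cauchy-Schwarz makes \<beta> the multiple \<open>c\<close> of
      \<alpha>; reducedness and \<open>c > 0\<close> then give \<beta> = \<alpha>.\<close>
    define c where "c = (\<beta> \<bullet> \<alpha>) / (\<alpha> \<bullet> \<alpha>)"
    have "(\<beta> - c *\<^sub>R \<alpha>) \<bullet> (\<beta> - c *\<^sub>R \<alpha>) = \<beta> \<bullet> \<beta> - (\<beta> \<bullet> \<alpha>)\<^sup>2 / (\<alpha> \<bullet> \<alpha>)"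
      using ne by (simp add: c_def inner_diff_left inner_diff_right inner_commute power2_eq_square)
    also have "\<dots> = 0"
      using ne \<open>(\<beta> \<bullet> \<alpha>)\<^sup>2 = _\<close> by simp
    finally have "\<beta> = c *\<^sub>R \<alpha>"
      by simp
    then have "c = 1 \<or> c = -1"
      using reduced assms Pos_in_R unfolding reduced_rs_def by blast
    moreover have "c > 0"
      using assms(4) ne by (simp add: c_def)
    ultimately show False
      using \<open>\<beta> = c *\<^sub>R \<alpha>\<close> assms(3) by simp
  qed
  moreover have "real_of_int (n * m) * ((\<beta> \<bullet> \<beta>) * (\<alpha> \<bullet> \<alpha>)) = 4 * (\<beta> \<bullet> \<alpha>)\<^sup>2"
    using ne n m by (simp flip: n m add: inner_coroot inner_commute power2_eq_square)
  moreover have "(\<beta> \<bullet> \<beta>) * (\<alpha> \<bullet> \<alpha>) > 0"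
    using ne by simp
  ultimately have "real_of_int (n * m) * ((\<beta> \<bullet> \<beta>) * (\<alpha> \<bullet> \<alpha>)) < 4 * ((\<beta> \<bullet> \<beta>) * (\<alpha> \<bullet> \<alpha>))"
    by linarith
  then have "real_of_int (n * m) < 4"
    using \<open>(\<beta> \<bullet> \<beta>) * (\<alpha> \<bullet> \<alpha>) > 0\<close> by (simp only: mult_less_cancel_right_pos)
  then have "n * m < 4"
    by linarith
  have "n = 1 \<or> m = 1"
  proof (rule ccontr)
    assume "\<not> ?thesis"
    then have "n \<ge> 2" "m \<ge> 2"
      using \<open>n > 0\<close> \<open>m > 0\<close> by auto
    then have "2 * 2 \<le> n * m"
      by (intro mult_mono) auto
    then show False
      using \<open>n * m < 4\<close> by simp
  qed
  then show ?thesis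
  proof
    assume "n = 1"
    then show ?thesis
      using refl_in_R[of \<alpha> \<beta>] assms Pos_in_R n by (simp add: refl_def)
  next
    assume "m = 1"
    then have "\<alpha> - \<beta> \<in> R"
      using refl_in_R[of \<beta> \<alpha>] assms Pos_in_R m by (simp add: refl_def)
    then show ?thesis
      using uminus_in_R by fastforce
  qed
qed

text \<open>If \<alpha> - \<beta> were positive, the simple root \<alpha> would split as \<beta> +
  (\<alpha> - \<beta>).\<close>

lemma Pos_diff_simple:
  assumes "\<alpha> \<in> Sim" "\<beta> \<in> Pos" "\<alpha> \<noteq> \<beta>" "\<beta> \<bullet> \<alpha> > 0"
  shows "\<beta> - \<alpha> \<in> Pos"
proof (rule ccontr)
  assume "\<beta> - \<alpha> \<notin> Pos"
  then have "\<alpha> - \<beta> \<in> Pos"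
    using Pos_or_uminus root_diff assms Sim_in_Pos by fastforce
  moreover have "\<alpha> = \<beta> + (\<alpha> - \<beta>)"
    by simp
  ultimately show False
    using assms(1,2) unfolding simple_roots_def by blast
qed

lemma not_Pos_scaleR: "\<alpha> \<in> Pos \<Longrightarrow> c *\<^sub>R \<alpha> \<in> Pos \<Longrightarrow> c = 1"
  using reduced Pos_in_R not_Pos_uminus unfolding reduced_rs_def
  by (metis scaleR_minus1_left)

text \<open>This stands in for the linear independence of the simple roots.\<close>

lemma Pos_sum_not_multiple_simple:
  assumes "\<alpha> \<in> Sim" "\<beta> \<in> Pos" "\<gamma> \<in> Pos" "\<alpha> \<noteq> \<beta>" "\<beta> + \<gamma> = real n *\<^sub>R \<alpha>"
  shows False
  using assms(2-)
proof (induction n arbitrary: \<beta> \<gamma>)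
  case 0
  then show ?case
    using not_Pos_uminus[of \<beta>] by (simp add: add_eq_0_iff)
next
  case (Suc n)
  \<comment> \<open>A summand proportional to \<alpha> equals \<alpha>, hence is \<gamma>; then
    \<beta> is proportional to \<alpha> too and equals it. The case \<open>c = 2\<close> keeps
    \<beta> - \<alpha> different from \<alpha> below.\<close>
  have np: "x \<noteq> c *\<^sub>R \<alpha>" if "x \<in> {\<beta>, \<gamma>}" for x c
  proof
    assume x: "x = c *\<^sub>R \<alpha>"
    then have "c = 1"
      using not_Pos_scaleR[of \<alpha> c] assms(1) Sim_in_Pos that Suc.prems by auto
    then have "x = \<gamma>" "\<gamma> = \<alpha>"
      using x that Suc.prems by auto
    then have "\<beta> = real n *\<^sub>R \<alpha>"
      using Suc.prems(4) by (simp add: algebra_simps)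
    then show False
      using not_Pos_scaleR[of \<alpha> "real n"] assms(1) Sim_in_Pos Suc.prems by auto
  qed
  have "\<alpha> \<bullet> \<alpha> > 0"
    using assms(1) Sim_in_Pos Pos_nonzero by simp
  then have "(\<beta> + \<gamma>) \<bullet> \<alpha> > 0"
    unfolding Suc.prems(4) by simp
  \<comment> \<open>Subtracting \<alpha> from a summand that pairs positively with it leaves a
    positive root and lowers the multiple by one.\<close>
  then consider "\<beta> \<bullet> \<alpha> > 0" | "\<gamma> \<bullet> \<alpha> > 0"
    by (force simp: inner_add_left)
  then show ?case
  proof cases
    case 1
    have "\<beta> - \<alpha> \<in> Pos"
      using Pos_diff_simple[of \<alpha> \<beta>] 1 Suc.prems assms(1) by auto
    moreover have "\<beta> - \<alpha> \<noteq> \<alpha>"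
      using np[of \<beta> 2] by (auto simp: scaleR_2 algebra_simps)
    moreover have "(\<beta> - \<alpha>) + \<gamma> = real n *\<^sub>R \<alpha>"
      using Suc.prems(4) by (simp add: algebra_simps)
    ultimately show False
      using Suc.IH[of "\<beta> - \<alpha>" \<gamma>] Suc.prems by metis
  next
    case 2
    have "\<gamma> - \<alpha> \<in> Pos"
      using Pos_diff_simple[of \<alpha> \<gamma>] 2 Suc.prems assms(1) np[of \<gamma> 1] by auto
    moreover have "\<beta> + (\<gamma> - \<alpha>) = real n *\<^sub>R \<alpha>"
      using Suc.prems(4) by (simp add: algebra_simps)
    ultimately show False
      using Suc.IH[of \<beta> "\<gamma> - \<alpha>"] Suc.prems by metis
  qed
qed

text \<open>A root and its image differ by a multiple of \<alpha>. A negative image would make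
  \<beta> and \<open>- refl \<alpha> \<beta>\<close> two positive roots whose sum is a natural
  multiple of \<alpha>, which \<open>Pos_sum_not_multiple_simple\<close> excludes.\<close>

lemma refl_simple_Pos:
  assumes "\<alpha> \<in> Sim" "\<beta> \<in> Pos" "\<alpha> \<noteq> \<beta>"
  shows "refl \<alpha> \<beta> \<in> Pos"
proof (rule ccontr)
  assume "refl \<alpha> \<beta> \<notin> Pos"
  then have neg: "- refl \<alpha> \<beta> \<in> Pos"
    using Pos_or_uminus refl_in_R assms Sim_in_R Pos_in_R by blast
  obtain n where n: "\<beta> \<bullet> coroot \<alpha> = of_int n"
    using root_coroot_Ints[of \<alpha> \<beta>] assms Sim_in_R Pos_in_R by (auto elim: Ints_cases)
  have sum: "\<beta> + - refl \<alpha> \<beta> = of_int n *\<^sub>R \<alpha>"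
    by (simp add: refl_def n)
  have "(\<beta> + - refl \<alpha> \<beta>) \<bullet> z > 0" "\<alpha> \<bullet> z > 0"
    using neg assms Sim_in_Pos by (auto simp: pos_roots_def inner_diff_left)
  then have "n > 0"
    unfolding sum by (simp add: zero_less_mult_iff)
  then show False
    using Pos_sum_not_multiple_simple[OF assms(1,2) neg assms(3), of "nat n"] sum by simp
qed

lemma refl_simple_ne:
  assumes "\<alpha> \<in> Sim" "\<beta> \<in> Pos"
  shows "refl \<alpha> \<beta> \<noteq> \<alpha>"
  using assms not_Pos_uminus[of \<alpha>] Sim_in_Pos by (metis refl_refl refl_self)

lemma refl_simple_image:
  assumes "\<alpha> \<in> Sim"
  shows "refl \<alpha> ` (Pos - {\<alpha>}) = Pos - {\<alpha>}"
proof -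
  have "refl \<alpha> ` (Pos - {\<alpha>}) \<subseteq> Pos - {\<alpha>}"
    using refl_simple_Pos[OF assms] refl_simple_ne[OF assms] by auto
  moreover from this have "refl \<alpha> ` refl \<alpha> ` (Pos - {\<alpha>}) \<subseteq> refl \<alpha> ` (Pos - {\<alpha>})"
    by (rule image_mono)
  ultimately show ?thesis
    by (simp add: image_image)
qed

text \<open>A positive root that is not simple is a sum of two positive roots with smaller pairing
  with \<open>z\<close>. These pairings are real numbers, so the induction runs on the number of
  positive roots below.\<close>

lemma nonneg_on_simple_imp_Pos:
  assumes "\<And>\<alpha>. \<alpha> \<in> Sim \<Longrightarrow> x \<bullet> \<alpha> \<ge> 0" "\<beta> \<in> Pos"
  shows "x \<bullet> \<beta> \<ge> 0"
  using assms(2)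
proof (induction "card {\<gamma> \<in> Pos. \<gamma> \<bullet> z < \<beta> \<bullet> z}" arbitrary: \<beta> rule: less_induct)
  case less
  show ?case
  proof (cases "\<beta> \<in> Sim")
    case False
    then obtain \<gamma> \<delta> where gd: "\<gamma> \<in> Pos" "\<delta> \<in> Pos" "\<beta> = \<gamma> + \<delta>"
      using less.prems unfolding simple_roots_def by blast
    then have pos: "\<gamma> \<bullet> z > 0" "\<delta> \<bullet> z > 0"
      by (auto simp: pos_roots_def)
    have "{\<epsilon> \<in> Pos. \<epsilon> \<bullet> z < \<phi> \<bullet> z} \<subset> {\<epsilon> \<in> Pos. \<epsilon> \<bullet> z < \<beta> \<bullet> z}" if "\<phi> \<in> {\<gamma>, \<delta>}" for \<phi>
      using gd pos that by (force simp: inner_add_left)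
    then have "card {\<epsilon> \<in> Pos. \<epsilon> \<bullet> z < \<phi> \<bullet> z} < card {\<epsilon> \<in> Pos. \<epsilon> \<bullet> z < \<beta> \<bullet> z}"
      if "\<phi> \<in> {\<gamma>, \<delta>}" for \<phi>
      using that finite_Pos by (intro psubset_card_mono) auto
    then have "x \<bullet> \<gamma> \<ge> 0" "x \<bullet> \<delta> \<ge> 0"
      using less.hyps gd by auto
    then show ?thesis
      using gd(3) by (simp add: inner_add_right)
  qed (use assms(1) in auto)
qed

text \<open>For non-simple \<beta> some simple \<alpha> pairs positively with it;
  \<open>refl \<alpha> \<beta>\<close> is then a lower positive root, and conjugating its reflection
  by \<open>refl \<alpha>\<close> gives \<open>refl \<beta>\<close>.\<close>

lemma refl_Pos_eq_refl_word:
  assumes "\<beta> \<in> Pos"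
  shows "\<exists>js. set js \<subseteq> Sim \<and> refl \<beta> = refl_word js"
  using assms
proof (induction "card {\<gamma> \<in> Pos. \<gamma> \<bullet> z < \<beta> \<bullet> z}" arbitrary: \<beta> rule: less_induct)
  case less
  show ?case
  proof (cases "\<beta> \<in> Sim")
    case True
    then show ?thesis
      by (intro exI[of _ "[\<beta>]"]) auto
  next
    case False
    \<comment> \<open>Otherwise - \<beta> is nonnegative on all simple roots, hence on \<beta>
      itself.\<close>
    have "\<exists>\<alpha>\<in>Sim. \<beta> \<bullet> \<alpha> > 0"
    proof (rule ccontr)
      assume "\<not> ?thesis"
      then have "- \<beta> \<bullet> \<alpha> \<ge> 0" if "\<alpha> \<in> Sim" for \<alpha>
        using that by force
      then have "- \<beta> \<bullet> \<beta> \<ge> 0"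
        using nonneg_on_simple_imp_Pos less.prems by blast
      then show False
        using Pos_nonzero[OF less.prems] inner_gt_zero_iff[of \<beta>] by (simp del: inner_gt_zero_iff)
    qed
    then obtain \<alpha> where \<alpha>: "\<alpha> \<in> Sim" "\<beta> \<bullet> \<alpha> > 0"
      by blast
    define \<gamma> where "\<gamma> = refl \<alpha> \<beta>"
    have "\<gamma> \<in> Pos"
      unfolding \<gamma>_def using refl_simple_Pos \<alpha> False less.prems by metis
    have "\<alpha> \<bullet> z > 0" "\<alpha> \<noteq> 0"
      using \<alpha> Sim_in_Pos Pos_nonzero by (auto simp: pos_roots_def)
    then have "\<gamma> \<bullet> z < \<beta> \<bullet> z"
      using \<alpha>(2) by (simp add: \<gamma>_def refl_def inner_diff_left coroot_pos_iff)
    then have "card {\<delta> \<in> Pos. \<delta> \<bullet> z < \<gamma> \<bullet> z} < card {\<delta> \<in> Pos. \<delta> \<bullet> z < \<beta> \<bullet> z}"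
      using finite_Pos \<open>\<gamma> \<in> Pos\<close> by (intro psubset_card_mono) force+
    then obtain js where js: "set js \<subseteq> Sim" "refl \<gamma> = refl_word js"
      using less.hyps \<open>\<gamma> \<in> Pos\<close> by blast
    have "refl \<beta> x = refl \<alpha> (refl \<gamma> (refl \<alpha> x))" for x
      unfolding \<gamma>_def refl_orthogonal_transformation[OF orthogonal_transformation_refl] by simp
    then have "refl \<beta> = refl_word (\<alpha> # js @ [\<alpha>])"
      using js by (simp add: fun_eq_iff)
    then show ?thesis
      using js \<alpha> by (intro exI[of _ "\<alpha> # js @ [\<alpha>]"]) auto
  qed
qed

lemma W0_eq_refl_word:
  assumes "w \<in> W0 R"
  obtains js where "set js \<subseteq> Sim" "w = refl_word js"
proof -
  have "\<exists>js. set js \<subseteq> Sim \<and> w = refl_word js"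
    using assms
  proof induction
    case W0_id
    then show ?case
      by (intro exI[of _ "[]"]) auto
  next
    case (W0_step w \<alpha>)
    then obtain js where js: "set js \<subseteq> Sim" "w = refl_word js"
      by blast
    obtain ks where "set ks \<subseteq> Sim" "refl \<alpha> = refl_word ks"
      using refl_Pos_eq_refl_word Pos_or_uminus[OF \<open>\<alpha> \<in> R\<close>] by (metis refl_uminus)
    then show ?case
      using js by (intro exI[of _ "ks @ js"]) auto
  qed
  then show ?thesis
    using that by blast
qed

lemma refl_word_in_W0: "set js \<subseteq> R \<Longrightarrow> refl_word js \<in> W0 R"
  by (induction js) (auto intro: W0.intros)

lemma refl_word_in_R: "set js \<subseteq> R \<Longrightarrow> \<beta> \<in> R \<Longrightarrow> refl_word js \<beta> \<in> R"
  by (induction js) (auto intro: refl_in_R)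

lemma Sim_set_in_R: "set js \<subseteq> Sim \<Longrightarrow> set js \<subseteq> R"
  using Sim_in_R by auto

text \<open>The exchange condition. As the letters act from the right, \<alpha> first turns negative
  at some letter \<beta>, and just before it has become \<beta>. So \<open>refl \<beta>\<close> is
  the conjugate of \<open>refl \<alpha>\<close> by the letters already applied, and this letter can
  be deleted.\<close>

lemma exchange:
  assumes "set js \<subseteq> Sim" "\<alpha> \<in> Sim" "refl_word js \<alpha> \<notin> Pos"
  shows "\<exists>ks. set ks \<subseteq> Sim \<and> Suc (length ks) = length js \<and> refl_word ks = refl_word js \<circ> refl \<alpha>"
  using assms
proof (induction js)
  case Nil
  then show ?case
    using Sim_in_Pos by simp
next
  case (Cons \<beta> js)
  show ?case
  proof (cases "refl_word js \<alpha> \<in> Pos")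
    case True
    \<comment> \<open>\<beta> is the only positive root that \<open>refl \<beta>\<close> makes
      negative.\<close>
    then have eq: "refl_word js \<alpha> = \<beta>"
      using refl_simple_Pos[of \<beta> "refl_word js \<alpha>"] Cons.prems by auto
    have "refl \<beta> (refl_word js (refl \<alpha> x)) = refl_word js x" for x
      unfolding eq[symmetric]
      by (simp add: refl_orthogonal_transformation[OF orthogonal_transformation_refl_word])
    then show ?thesis
      using Cons.prems by (intro exI[of _ js]) (auto simp: fun_eq_iff)
  next
    case False
    moreover have "set js \<subseteq> Sim"
      using Cons.prems by simp
    ultimately obtain ks where "set ks \<subseteq> Sim" "Suc (length ks) = length js"
      "refl_word ks = refl_word js \<circ> refl \<alpha>"
      using Cons.IH Cons.prems(2) by blast
    then show ?thesis
      using Cons.prems by (intro exI[of _ "\<beta> # ks"]) (simp add: o_assoc)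
  qed
qed

section \<open>Inversion sets and minimal words in the simple reflections\<close>

definition inversions :: "('a \<Rightarrow> 'a) \<Rightarrow> 'a set" where
  "inversions w = {\<beta> \<in> Pos. w \<beta> \<notin> Pos}"

lemma finite_inversions: "finite (inversions w)"
  using finite_Pos by (simp add: inversions_def)

text \<open>\<open>refl \<alpha>\<close> permutes the positive roots other than \<alpha>, so the
  inversions other than \<alpha> keep their number; \<alpha> itself changes status, because
  \<open>refl \<alpha>\<close> negates it.\<close>

lemma card_inversions_comp_refl:
  assumes "\<alpha> \<in> Sim" "w \<alpha> \<in> R" "linear w"
  shows "w \<alpha> \<in> Pos \<Longrightarrow> card (inversions (w \<circ> refl \<alpha>)) = Suc (card (inversions w))"
    and "w \<alpha> \<notin> Pos \<Longrightarrow> Suc (card (inversions (w \<circ> refl \<alpha>))) = card (inversions w)"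
proof -
  have "inversions (w \<circ> refl \<alpha>) - {\<alpha>} = refl \<alpha> ` (inversions w - {\<alpha>})"
  proof -
    have "inversions v - {\<alpha>} = {\<beta> \<in> Pos - {\<alpha>}. v \<beta> \<notin> Pos}" for v
      by (auto simp: inversions_def)
    moreover have "{\<beta> \<in> refl \<alpha> ` (Pos - {\<alpha>}). w (refl \<alpha> \<beta>) \<notin> Pos}
        = refl \<alpha> ` {\<beta> \<in> Pos - {\<alpha>}. w \<beta> \<notin> Pos}"
      by auto
    ultimately show ?thesis
      using refl_simple_image[OF assms(1)] by simp
  qed
  moreover have "inj (refl \<alpha>)"
    by (metis injI refl_refl)
  ultimately have eq: "card (inversions (w \<circ> refl \<alpha>) - {\<alpha>}) = card (inversions w - {\<alpha>})"
    by (metis card_image inj_on_subset subset_UNIV)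
  have \<alpha>: "\<alpha> \<in> Pos"
    using assms Sim_in_Pos by blast
  have w: "w (refl \<alpha> \<alpha>) = - w \<alpha>"
    using assms(3) by (simp add: refl_self linear_neg)
  {
    assume "w \<alpha> \<in> Pos"
    then have "\<alpha> \<in> inversions (w \<circ> refl \<alpha>)" "\<alpha> \<notin> inversions w"
      using \<alpha> not_Pos_uminus by (auto simp: inversions_def w)
    then show "card (inversions (w \<circ> refl \<alpha>)) = Suc (card (inversions w))"
      using eq finite_inversions[of "w \<circ> refl \<alpha>"]
      by (metis Diff_empty Diff_insert0 card_Suc_Diff1)
  }
  {
    assume "w \<alpha> \<notin> Pos"
    then have "\<alpha> \<notin> inversions (w \<circ> refl \<alpha>)" "\<alpha> \<in> inversions w"
      using \<alpha> assms(2) Pos_or_uminus by (auto simp: inversions_def w)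
    then show "Suc (card (inversions (w \<circ> refl \<alpha>))) = card (inversions w)"
      using eq finite_inversions[of w] by (metis Diff_empty Diff_insert0 card_Suc_Diff1)
  }
qed

text \<open>A letter appended on the right either adds one inversion, and the word grows with it, or
  removes one, and \<open>exchange\<close> supplies a word shorter by one.\<close>

lemma minimal_refl_word:
  assumes "w \<in> W0 R"
  obtains js where "set js \<subseteq> Sim" "w = refl_word js" "length js = card (inversions w)"
proof -
  obtain js where "set js \<subseteq> Sim" "w = refl_word js"
    using W0_eq_refl_word assms by blast
  then have "\<exists>ks. set ks \<subseteq> Sim \<and> w = refl_word ks \<and> length ks = card (inversions w)"
  proof (induction js arbitrary: w rule: rev_induct)
    case Nil
    then show ?case
      by (intro exI[of _ "[]"]) (simp add: inversions_def)
  next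
    case (snoc \<alpha> js)
    then have "set js \<subseteq> Sim"
      by simp
    then obtain ks where ks: "set ks \<subseteq> Sim" "refl_word js = refl_word ks"
      "length ks = card (inversions (refl_word js))"
      using snoc.IH by blast
    have w: "w = refl_word ks \<circ> refl \<alpha>"
      unfolding snoc.prems(2) by (simp add: ks(2))
    have \<alpha>: "\<alpha> \<in> Sim" "refl_word ks \<alpha> \<in> R" "linear (refl_word ks)"
      using snoc ks(1) refl_word_in_R[OF Sim_set_in_R[OF ks(1)]] Sim_in_R
        linear_refl_word by auto
    show ?case
    proof (cases "refl_word ks \<alpha> \<in> Pos")
      case True
      then have "card (inversions w) = Suc (length ks)"
        using card_inversions_comp_refl(1)[OF \<alpha>] w ks by simp
      then show ?thesis
        using ks \<alpha> w by (intro exI[of _ "ks @ [\<alpha>]"]) (auto simp: comp_def)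
    next
      case False
      then have "Suc (card (inversions w)) = length ks"
        using card_inversions_comp_refl(2)[OF \<alpha>] w ks by simp
      then show ?thesis
        using exchange[OF ks(1) \<alpha>(1) False] w by (metis nat.inject)
    qed
  qed
  then show ?thesis
    using that by blast
qed

lemma card_inversions_refl_word_le:
  assumes "set js \<subseteq> Sim"
  shows "card (inversions (refl_word js)) \<le> length js"
  using assms
proof (induction js rule: rev_induct)
  case Nil
  then show ?case
    by (simp add: inversions_def)
next
  case (snoc \<alpha> js)
  then have \<alpha>: "\<alpha> \<in> Sim" "refl_word js \<alpha> \<in> R" "linear (refl_word js)"
    using refl_word_in_R[OF Sim_set_in_R] Sim_in_R
      linear_refl_word by auto
  show ?case
    using card_inversions_comp_refl[OF \<alpha>] snoc
    by (cases "refl_word js \<alpha> \<in> Pos") (simp_all add: comp_def)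
qed

text \<open>\<open>v\<close> composed with the inverse of \<open>w\<close> keeps every positive root
  positive, so it has no inversions and \<open>minimal_refl_word\<close> spells it by the empty
  word.\<close>

lemma inversions_inject:
  assumes "v \<in> W0 R" "w \<in> W0 R" "inversions v = inversions w"
  shows "v = w"
proof -
  obtain js where js: "set js \<subseteq> Sim" "v = refl_word js"
    using W0_eq_refl_word assms by blast
  obtain ks where ks: "set ks \<subseteq> Sim" "w = refl_word ks"
    using W0_eq_refl_word assms by blast
  let ?u = "refl_word (js @ rev ks)"
  have "?u \<beta> \<in> Pos" if \<beta>: "\<beta> \<in> Pos" for \<beta>
  proof -
    define \<gamma> where "\<gamma> = refl_word (rev ks) \<beta>"
    have w\<gamma>: "w \<gamma> = \<beta>"
      by (simp add: \<gamma>_def ks)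
    have "\<gamma> \<in> R"
      unfolding \<gamma>_def using \<beta> Pos_in_R refl_word_in_R[of "rev ks"] Sim_set_in_R[OF ks(1)] by simp
    then have "v \<gamma> \<in> R"
      using js refl_word_in_R[OF Sim_set_in_R[OF js(1)]] by simp
    have "v \<gamma> \<in> Pos"
    proof (cases "\<gamma> \<in> Pos")
      case True
      then show ?thesis
        using assms(3) w\<gamma> \<beta> by (auto simp: inversions_def)
    next
      case False
      then have "- \<gamma> \<in> Pos"
        using \<open>\<gamma> \<in> R\<close> Pos_or_uminus by blast
      moreover have "w (- \<gamma>) \<notin> Pos"
        using w\<gamma> \<beta> not_Pos_uminus linear_refl_word[of ks] by (simp add: ks linear_neg)
      ultimately have "v (- \<gamma>) \<notin> Pos"
        using assms(3) by (auto simp: inversions_def)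
      then show ?thesis
        using \<open>v \<gamma> \<in> R\<close> Pos_or_uminus linear_refl_word[of js] by (force simp: js linear_neg)
    qed
    then show ?thesis
      by (simp add: \<gamma>_def js)
  qed
  then have "inversions ?u = {}"
    by (auto simp: inversions_def)
  moreover have "?u \<in> W0 R"
    using js ks Sim_in_R by (intro refl_word_in_W0) auto
  ultimately have "?u = id"
    using minimal_refl_word[of ?u] by (metis card.empty length_0_conv refl_word_simps(1))
  then have "refl_word js (refl_word (rev ks) (refl_word ks x)) = refl_word ks x" for x
    by (simp add: fun_eq_iff del: refl_word_rev refl_word_rev')
  then show ?thesis
    unfolding refl_word_rev by (simp add: js ks fun_eq_iff)
qed

section \<open>The alcove and the geometric length\<close>

lemma alcove_nonempty: "alcove R z \<noteq> {}"
proof -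
  \<comment> \<open>\<open>z\<close> pairs positively with every positive coroot and
    \<open>c\<close> exceeds all these pairings, so \<open>z\<close> divided by \<open>c\<close>
    lies in the alcove. A point is needed because \<open>separates\<close> holds vacuously for empty
    sets.\<close>
  define c where "c = 1 + (\<Sum>\<alpha>\<in>Pos. z \<bullet> coroot \<alpha>)"
  have pos: "z \<bullet> coroot \<alpha> > 0" if "\<alpha> \<in> Pos" for \<alpha>
    using that Pos_nonzero[OF that]
    by (simp add: coroot_pos_iff pos_roots_def inner_commute)
  have "z \<bullet> coroot \<alpha> < c" if "\<alpha> \<in> Pos" for \<alpha>
    unfolding c_def
    using member_le_sum[OF that, of "\<lambda>\<alpha>. z \<bullet> coroot \<alpha>"] pos finite_Pos by fastforce
  moreover have "c > 0"
    unfolding c_def using sum_nonneg[of Pos "\<lambda>\<alpha>. z \<bullet> coroot \<alpha>"] pos by fastforce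
  ultimately have "(1 / c) *\<^sub>R z \<in> alcove R z"
    using pos by (simp add: alcove_def)
  then show ?thesis
    by blast
qed

lemma alcove_root:
  assumes "x \<in> alcove R z" "\<beta> \<in> R"
  shows "if \<beta> \<in> Pos then 0 < x \<bullet> coroot \<beta> \<and> x \<bullet> coroot \<beta> < 1
    else -1 < x \<bullet> coroot \<beta> \<and> x \<bullet> coroot \<beta> < 0"
proof (cases "\<beta> \<in> Pos")
  case False
  then have "- \<beta> \<in> Pos"
    using Pos_or_uminus assms by blast
  then have "0 < x \<bullet> coroot (- \<beta>)" "x \<bullet> coroot (- \<beta>) < 1"
    using assms(1) unfolding alcove_def by blast+
  then show ?thesis
    using False by simp
qed (use assms(1) in \<open>auto simp: alcove_def\<close>)

text \<open>Alcove points pair with coroots strictly between -1 and 1, so only hyperplanes through 0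
  separate. The one orthogonal to \<open>w \<beta>\<close>, for positive \<beta>, does so exactly
  when \<open>w \<beta>\<close> is negative.\<close>

lemma len_eq_card_inversions:
  assumes "w \<in> W0 R"
  shows "len R z w = card (inversions w)"
proof -
  obtain js where js: "set js \<subseteq> R" "w = refl_word js"
    using W0_eq_refl_word[OF assms] Sim_set_in_R by metis
  have orth: "orthogonal_transformation w"
    by (simp add: js orthogonal_transformation_refl_word)
  have lin: "w (- x) = - w x" "w (c *\<^sub>R x) = c *\<^sub>R w x" for x c
    using linear_refl_word[of js] by (simp_all add: js linear_neg linear_cmul)
  have inj: "w x = w y \<Longrightarrow> x = y" for x y
    by (metis js(2) refl_word_rev)
  have wR: "w \<beta> \<in> R" if "\<beta> \<in> R" for \<beta>
    using that js refl_word_in_R by blast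
  have inner_w: "w x \<bullet> coroot (w \<beta>) = x \<bullet> coroot \<beta>" for x \<beta>
    using orth by (simp add: coroot_orthogonal_transformation orthogonal_transformation_def)
  define plane where "plane \<beta> = {x. x \<bullet> coroot (w \<beta>) = 0}" for \<beta>
  have "{H. \<exists>\<alpha>\<in>R. \<exists>k::int. H = {x. x \<bullet> coroot \<alpha> = of_int k}
        \<and> separates \<alpha> (of_int k) (alcove R z) (w ` alcove R z)} = plane ` inversions w"
    (is "?S = _")
  proof (intro equalityI subsetI)
    fix H assume "H \<in> ?S"
    then obtain \<alpha> k where \<alpha>: "\<alpha> \<in> R" "H = {x. x \<bullet> coroot \<alpha> = of_int k}"
      and sep: "separates \<alpha> (of_int k) (alcove R z) (w ` alcove R z)"
      by blast
    \<comment> \<open>The preimage of \<alpha> under \<open>w\<close>: the pairing of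
      \<open>w x\<close> with the coroot of \<alpha> is that of \<open>x\<close> with the coroot of
      \<beta>.\<close>
    define \<beta> where "\<beta> = refl_word (rev js) \<alpha>"
    have \<beta>: "\<beta> \<in> R" "w \<beta> = \<alpha>"
      using \<alpha>(1) js refl_word_in_R[of "rev js"] by (simp_all add: \<beta>_def)
    obtain x where x: "x \<in> alcove R z"
      using alcove_nonempty by blast
    have between: "x \<bullet> coroot \<alpha> < k \<and> k < x \<bullet> coroot \<beta> \<or> x \<bullet> coroot \<beta> < k \<and> k < x \<bullet> coroot \<alpha>"
      using sep x inner_w[of x \<beta>] unfolding separates_def \<beta>(2) by (metis image_eqI)
    note bounds = alcove_root[OF x \<alpha>(1)] alcove_root[OF x \<beta>(1)]
    have "real_of_int k < 1" "real_of_int k > -1"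
      using between bounds by (auto split: if_splits)
    then have k0: "k = 0"
      by linarith
    then have diff: "\<alpha> \<in> Pos \<longleftrightarrow> \<beta> \<notin> Pos"
      using between bounds by (auto split: if_splits)
    show "H \<in> plane ` inversions w"
    proof (cases "\<beta> \<in> Pos")
      case True
      then have "\<beta> \<in> inversions w"
        using diff \<beta> by (simp add: inversions_def)
      then show ?thesis
        using \<alpha>(2) k0 \<beta>(2) by (auto simp: plane_def)
    next
      case False
      then have "- \<beta> \<in> inversions w"
        using diff \<beta> Pos_or_uminus not_Pos_uminus by (auto simp: inversions_def lin)
      moreover have "H = plane (- \<beta>)"
        using \<alpha>(2) k0 \<beta>(2) by (simp add: plane_def lin)
      ultimately show ?thesis
        by blast
    qed
  next
    fix H assume "H \<in> plane ` inversions w"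
    then obtain \<beta> where \<beta>: "\<beta> \<in> Pos" "w \<beta> \<notin> Pos" "H = plane \<beta>"
      by (auto simp: inversions_def)
    have "w \<beta> \<in> R"
      using \<beta> Pos_in_R wR by blast
    moreover have "separates (w \<beta>) (of_int 0) (alcove R z) (w ` alcove R z)"
      unfolding separates_def
      using alcove_root[OF _ \<open>w \<beta> \<in> R\<close>] alcove_root[OF _ Pos_in_R[OF \<beta>(1)]] \<beta>(1,2)
      by (simp add: inner_w)
    ultimately show "H \<in> ?S"
      using \<beta>(3) unfolding plane_def by force
  qed
  moreover have "inj_on plane (inversions w)"
  proof
    fix \<beta> \<gamma> assume *: "\<beta> \<in> inversions w" "\<gamma> \<in> inversions w" "plane \<beta> = plane \<gamma>"
    then have bg: "\<beta> \<in> Pos" "\<gamma> \<in> Pos"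
      by (auto simp: inversions_def)
    have ne: "w \<beta> \<noteq> 0" "w \<gamma> \<noteq> 0"
      using bg wR Pos_in_R zero_notin_R by metis+
    then have "coroot (w \<beta>) \<noteq> 0"
      by (simp add: coroot_def)
    \<comment> \<open>Equal hyperplanes have proportional normals, so \<beta> and \<gamma> are
      proportional, and distinct positive roots never are.\<close>
    then obtain c where "coroot (w \<gamma>) = c *\<^sub>R coroot (w \<beta>)"
      using *(3) hyperplane_eq_imp_scaleR[of "coroot (w \<beta>)" "coroot (w \<gamma>)"]
      unfolding plane_def by blast
    then have "((w \<gamma> \<bullet> w \<gamma>) / 2) *\<^sub>R coroot (w \<gamma>)
        = ((w \<gamma> \<bullet> w \<gamma>) / 2 * c * (2 / (w \<beta> \<bullet> w \<beta>))) *\<^sub>R w \<beta>"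
      by (simp add: coroot_def)
    moreover have "((w \<gamma> \<bullet> w \<gamma>) / 2) *\<^sub>R coroot (w \<gamma>) = w \<gamma>"
      using ne by (simp add: coroot_def)
    ultimately obtain d where "w \<gamma> = w (d *\<^sub>R \<beta>)"
      by (metis lin(2))
    then have "\<gamma> = d *\<^sub>R \<beta>"
      by (rule inj)
    then show "\<beta> = \<gamma>"
      using not_Pos_scaleR bg by force
  qed
  ultimately show ?thesis
    unfolding len_def by (simp add: card_image)
qed

lemma W0_inv: "w \<in> W0 R \<Longrightarrow> inv w \<in> W0 R"
  by (metis W0_eq_refl_word inv_refl_word refl_word_in_W0 Sim_set_in_R set_rev)

text \<open>A minimal word read backwards spells the inverse, which gives one inequality; applied to
  the inverse it gives the other.\<close>

lemma card_inversions_inv: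
  assumes "w \<in> W0 R"
  shows "card (inversions (inv w)) = card (inversions w)"
proof -
  have le: "card (inversions (inv v)) \<le> card (inversions v)" if v: "v \<in> W0 R" for v
  proof -
    obtain js where "set js \<subseteq> Sim" "v = refl_word js" "length js = card (inversions v)"
      using minimal_refl_word[OF v] by blast
    then show ?thesis
      using card_inversions_refl_word_le[of "rev js"] by (simp add: inv_refl_word)
  qed
  obtain js where "w = refl_word js"
    using W0_eq_refl_word assms by blast
  then have "inv (inv w) = w"
    by (simp add: inv_refl_word)
  then show ?thesis
    using le[OF assms] le[OF W0_inv[OF assms]] by simp
qed

lemma reduced_word_exists:
  assumes "w \<in> W0 R"
  obtains js where "reduced_word R z w js"
  using minimal_refl_word[OF assms] len_eq_card_inversions[OF assms]
  by (metis reduced_word_def refl_word_def)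

section \<open>Distance of a weight from the dominant chamber\<close>

definition neg_count :: "'a \<Rightarrow> nat" where
  "neg_count x = card {\<beta> \<in> Pos. x \<bullet> \<beta> < 0}"

text \<open>\<open>refl \<alpha>\<close> permutes the other positive roots, so the count over them
  is unchanged, while \<alpha> itself turns from positive to negative.\<close>

lemma neg_count_refl_pos:
  assumes "\<alpha> \<in> Sim" "x \<bullet> \<alpha> > 0"
  shows "neg_count (refl \<alpha> x) = Suc (neg_count x)"
proof -
  have \<alpha>: "\<alpha> \<in> Pos"
    using assms Sim_in_Pos by blast
  have "{\<beta> \<in> refl \<alpha> ` (Pos - {\<alpha>}). x \<bullet> refl \<alpha> \<beta> < 0}
      = refl \<alpha> ` {\<beta> \<in> Pos - {\<alpha>}. x \<bullet> \<beta> < 0}"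
    by auto
  then have "{\<beta> \<in> Pos - {\<alpha>}. refl \<alpha> x \<bullet> \<beta> < 0} = refl \<alpha> ` {\<beta> \<in> Pos - {\<alpha>}. x \<bullet> \<beta> < 0}"
    unfolding refl_simple_image[OF assms(1)] inner_refl_left .
  moreover have "{\<beta> \<in> Pos - {\<alpha>}. x \<bullet> \<beta> < 0} = {\<beta> \<in> Pos. x \<bullet> \<beta> < 0}"
    using assms(2) by auto
  moreover have "{\<beta> \<in> Pos. refl \<alpha> x \<bullet> \<beta> < 0} = insert \<alpha> {\<beta> \<in> Pos - {\<alpha>}. refl \<alpha> x \<bullet> \<beta> < 0}"
    using assms(2) \<alpha> by (auto simp: inner_refl_left refl_self)
  ultimately have "{\<beta> \<in> Pos. refl \<alpha> x \<bullet> \<beta> < 0} = insert \<alpha> (refl \<alpha> ` {\<beta> \<in> Pos. x \<bullet> \<beta> < 0})"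
    and "\<alpha> \<notin> refl \<alpha> ` {\<beta> \<in> Pos. x \<bullet> \<beta> < 0}"
    by auto
  moreover have "inj_on (refl \<alpha>) A" for A
    by (metis inj_onI refl_refl)
  ultimately show ?thesis
    unfolding neg_count_def using finite_Pos by (simp add: card_image)
qed

lemma neg_count_refl_neg:
  assumes "\<alpha> \<in> Sim" "x \<bullet> \<alpha> < 0"
  shows "Suc (neg_count (refl \<alpha> x)) = neg_count x"
  using neg_count_refl_pos[OF assms(1), of "refl \<alpha> x"] assms(2)
  by (simp add: inner_refl_left refl_self)

lemma neg_count_refl_le:
  assumes "\<alpha> \<in> Sim"
  shows "neg_count (refl \<alpha> x) \<le> Suc (neg_count x)"
proof (cases "x \<bullet> \<alpha> = 0")
  case True
  then show ?thesis
    by (simp add: refl_def inner_coroot)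
next
  case False
  then show ?thesis
    using neg_count_refl_pos[OF assms, of x] neg_count_refl_neg[OF assms, of x] by linarith
qed

lemma neg_count_refl_word_le:
  "set js \<subseteq> Sim \<Longrightarrow> neg_count (refl_word js x) \<le> neg_count x + length js"
proof (induction js)
  case (Cons \<alpha> js)
  then show ?case
    using neg_count_refl_le[of \<alpha> "refl_word js x"] by auto
qed simp

lemma root_in_P: "\<alpha> \<in> R \<Longrightarrow> \<alpha> \<in> P"
  using root_coroot_Ints by (auto simp: weights_def)

lemma P_diff_multiple: "x \<in> P \<Longrightarrow> \<alpha> \<in> R \<Longrightarrow> x - of_int k *\<^sub>R \<alpha> \<in> P"
  using root_in_P[of \<alpha>] by (auto simp: weights_def inner_diff_left intro!: Ints_diff Ints_mult)

lemma P_inner_coroot: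
  assumes "x \<in> P" "\<alpha> \<in> R"
  obtains m where "x \<bullet> coroot \<alpha> = of_int m"
  using assms by (auto simp: weights_def elim: Ints_cases)

lemma refl_in_P: "x \<in> P \<Longrightarrow> \<alpha> \<in> R \<Longrightarrow> refl \<alpha> x \<in> P"
  by (metis P_inner_coroot P_diff_multiple refl_def)

lemma dominant_iff: "x \<in> dominant R z \<longleftrightarrow> x \<in> P \<and> neg_count x = 0"
proof -
  have "(\<forall>\<alpha>\<in>Sim. x \<bullet> coroot \<alpha> \<ge> 0) \<longleftrightarrow> (\<forall>\<alpha>\<in>Sim. x \<bullet> \<alpha> \<ge> 0)"
    using coroot_neg_iff Sim_in_Pos Pos_nonzero by (meson not_less)
  also have "\<dots> \<longleftrightarrow> (\<forall>\<beta>\<in>Pos. x \<bullet> \<beta> \<ge> 0)"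
    using nonneg_on_simple_imp_Pos Sim_in_Pos by blast
  also have "\<dots> \<longleftrightarrow> neg_count x = 0"
    using finite_Pos by (auto simp: neg_count_def not_less)
  finally show ?thesis
    by (auto simp: dominant_def)
qed

text \<open>Reflecting in a simple root on which \<open>x\<close> is negative lowers
  \<open>neg_count\<close> by exactly one. The exact length shows in \<open>wmin\<close> that the
  word is a shortest one.\<close>

lemma to_dominant_word:
  assumes "x \<in> P"
  shows "\<exists>js. set js \<subseteq> Sim \<and> length js = neg_count x \<and> refl_word js x \<in> dominant R z"
  using assms
proof (induction "neg_count x" arbitrary: x)
  case 0
  then show ?case
    by (intro exI[of _ "[]"]) (simp add: dominant_iff)
next
  case (Suc n)
  then have "x \<notin> dominant R z"
    by (simp add: dominant_iff)
  then obtain \<alpha> where \<alpha>: "\<alpha> \<in> Sim" "x \<bullet> coroot \<alpha> < 0"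
    using Suc.prems by (auto simp: dominant_def not_le)
  then have "x \<bullet> \<alpha> < 0"
    using coroot_neg_iff Sim_in_Pos Pos_nonzero by blast
  then have "n = neg_count (refl \<alpha> x)"
    using neg_count_refl_neg[OF \<alpha>(1)] Suc.hyps(2) by fastforce
  then obtain js where "set js \<subseteq> Sim" "length js = n" "refl_word js (refl \<alpha> x) \<in> dominant R z"
    using Suc.hyps(1) refl_in_P Suc.prems \<alpha>(1) Sim_in_R by metis
  then show ?case
    using \<alpha>(1) Suc.hyps(2) by (intro exI[of _ "js @ [\<alpha>]"]) auto
qed

text \<open>Pairing \<open>w \<beta>\<close> with the dominant \<open>w x\<close> returns the
  negative number \<open>x \<bullet> \<beta>\<close>, which is impossible for a positive
  root.\<close>

lemma neg_subset_inversions: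
  assumes "w \<in> W0 R" "w x \<in> dominant R z"
  shows "{\<beta> \<in> Pos. x \<bullet> \<beta> < 0} \<subseteq> inversions w"
proof -
  obtain js where "w = refl_word js"
    using W0_eq_refl_word assms by blast
  then have "w x \<bullet> w \<beta> = x \<bullet> \<beta>" for \<beta>
    using orthogonal_transformation_refl_word by (auto simp: orthogonal_transformation_def)
  moreover have "w x \<bullet> \<beta> \<ge> 0" if "\<beta> \<in> Pos" for \<beta>
    using assms(2) that finite_Pos by (auto simp: dominant_iff neg_count_def not_less)
  ultimately show ?thesis
    by (force simp: inversions_def)
qed

text \<open>
  Every \<open>w\<close> that makes \<open>x\<close> dominant inverts all positive roots on which \<open>x\<close> is negative; the shortest
  ones invert nothing else, and an element of the Weyl group is determined by its inversions.
\<close>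

lemma wmin:
  assumes "x \<in> P"
  shows "wmin R z x \<in> W0 R" "wmin R z x x \<in> dominant R z"
    "card (inversions (wmin R z x)) = neg_count x"
proof -
  let ?neg = "{\<beta> \<in> Pos. x \<bullet> \<beta> < 0}"
  let ?S = "\<lambda>w. w \<in> W0 R \<and> w x \<in> dominant R z"
  obtain js where js: "set js \<subseteq> Sim" "length js = neg_count x" "refl_word js x \<in> dominant R z"
    using to_dominant_word assms by blast
  define u where "u = refl_word js"
  have u: "?S u"
    using js refl_word_in_W0 Sim_set_in_R by (simp add: u_def)
  have ge: "neg_count x \<le> card (inversions w)" if "?S w" for w
    unfolding neg_count_def using that neg_subset_inversions finite_inversions
    by (intro card_mono) auto
  have inv_eq: "inversions w = ?neg" if "?S w" "card (inversions w) \<le> neg_count x" for w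
    using neg_subset_inversions[of w x] that finite_inversions[of w]
    by (metis (no_types, lifting) card_seteq neg_count_def)
  have u_card: "card (inversions u) = neg_count x"
    using card_inversions_refl_word_le[OF js(1)] ge[OF u] js(2) by (simp add: u_def)
  have "wmin R z x = u"
    unfolding wmin_def
  proof (rule the_equality)
    show "u \<in> W0 R \<and> u x \<in> dominant R z
        \<and> (\<forall>v\<in>W0 R. v x \<in> dominant R z \<longrightarrow> len R z u \<le> len R z v)"
      using u u_card ge by (simp add: len_eq_card_inversions)
  next
    fix w assume w: "w \<in> W0 R \<and> w x \<in> dominant R z
        \<and> (\<forall>v\<in>W0 R. v x \<in> dominant R z \<longrightarrow> len R z w \<le> len R z v)"
    then have "card (inversions w) \<le> neg_count x"
      using u u_card len_eq_card_inversions by metis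
    then have "inversions w = inversions u"
      using inv_eq[of w] inv_eq[of u] w u u_card by simp
    then show "w = u"
      using inversions_inject w u by blast
  qed
  then show "wmin R z x \<in> W0 R" "wmin R z x x \<in> dominant R z"
    "card (inversions (wmin R z x)) = neg_count x"
    using u u_card by auto
qed

section \<open>A well-founded order on the weights\<close>

lemma finite_weights_ball: "finite {x \<in> P. x \<bullet> x < b}"
proof -
  \<comment> \<open>A weight in the ball is encoded by its pairings with the coroots. These are
    integers, and Cauchy-Schwarz with the sum of all coroot norms bounds them by one
    \<open>N\<close>.\<close>
  define N where "N = \<lceil>sqrt b * (\<Sum>\<alpha>\<in>R. norm (coroot \<alpha>))\<rceil>"
  define \<phi> where "\<phi> x = restrict (\<lambda>\<alpha>. \<lfloor>x \<bullet> coroot \<alpha>\<rfloor>) R" for x :: 'a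
  have "\<phi> x \<in> PiE R (\<lambda>_. {-N..N})" if x: "x \<in> P" "x \<bullet> x < b" for x
  proof -
    have "\<lfloor>x \<bullet> coroot \<alpha>\<rfloor> \<in> {-N..N}" if \<alpha>: "\<alpha> \<in> R" for \<alpha>
    proof -
      obtain m where m: "x \<bullet> coroot \<alpha> = of_int m"
        using P_inner_coroot x \<alpha> by blast
      have "\<bar>x \<bullet> coroot \<alpha>\<bar> \<le> norm x * norm (coroot \<alpha>)"
        by (rule Cauchy_Schwarz_ineq2)
      also have "\<dots> \<le> sqrt b * (\<Sum>\<alpha>\<in>R. norm (coroot \<alpha>))"
      proof (rule mult_mono)
        show "norm x \<le> sqrt b"
          using x(2) by (simp add: norm_eq_sqrt_inner)
        show "norm (coroot \<alpha>) \<le> (\<Sum>\<alpha>\<in>R. norm (coroot \<alpha>))"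
          using member_le_sum[OF \<alpha>, of "\<lambda>\<alpha>. norm (coroot \<alpha>)"] finite_R by simp
        show "0 \<le> sqrt b"
          using x(2) inner_ge_zero[of x] by (simp del: inner_ge_zero)
      qed simp
      also have "\<dots> \<le> of_int N"
        by (simp add: N_def)
      finally show ?thesis
        unfolding m by simp linarith
    qed
    then show ?thesis
      by (auto simp: \<phi>_def)
  qed
  then have "\<phi> ` {x \<in> P. x \<bullet> x < b} \<subseteq> PiE R (\<lambda>_. {-N..N})"
    by auto
  moreover have "finite (PiE R (\<lambda>_. {-N..N}))"
    by (simp add: finite_PiE finite_R)
  moreover have "inj_on \<phi> {x \<in> P. x \<bullet> x < b}"
  proof
    fix x y assume x: "x \<in> {x \<in> P. x \<bullet> x < b}" and y: "y \<in> {x \<in> P. x \<bullet> x < b}" and eq: "\<phi> x = \<phi> y"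
    \<comment> \<open>Equal pairings make \<open>x - y\<close> orthogonal to all roots, which span
      the space.\<close>
    have "(x - y) \<bullet> \<alpha> = 0" if \<alpha>: "\<alpha> \<in> R" for \<alpha>
    proof -
      obtain m n where mn: "x \<bullet> coroot \<alpha> = of_int m" "y \<bullet> coroot \<alpha> = of_int n"
        using P_inner_coroot[OF _ \<alpha>] x y by (metis (no_types, lifting) mem_Collect_eq)
      have "\<phi> x \<alpha> = \<phi> y \<alpha>"
        using eq by simp
      then have "m = n"
        using \<alpha> by (simp add: \<phi>_def mn)
      then have "(x - y) \<bullet> coroot \<alpha> = 0"
        by (simp add: inner_diff_left mn)
      then show ?thesis
        using \<alpha> zero_notin_R by (auto simp: inner_coroot)
    qed
    then have "orthogonal (x - y) v" if "v \<in> span R" for v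
      using orthogonal_to_span[OF that, of "x - y"] by (simp add: orthogonal_def)
    then have "(x - y) \<bullet> (x - y) = 0"
      using span_R by (simp add: orthogonal_def)
    then show "x = y"
      by simp
  qed
  ultimately show ?thesis
    by (meson finite_imageD finite_subset)
qed

text \<open>The tie-break compares all weights of equal norm, not only those in one orbit, so orbits
  never have to be mentioned.\<close>

definition prec :: "('a \<times> 'a) set" where
  "prec = {(y, x). y \<in> P \<and> x \<in> P \<and> (y \<bullet> y < x \<bullet> x \<or> y \<bullet> y = x \<bullet> x \<and> neg_count y < neg_count x)}"

text \<open>Counting the weights in the open ball turns the norm into a natural number: a shorter
  weight \<open>y\<close> lies in the ball of \<open>x\<close> but not in its own, and equal norms
  give equal counts.\<close>

lemma wf_prec: "wf prec"
proof -
  define \<mu> where "\<mu> x = (card {y \<in> P. y \<bullet> y < x \<bullet> x}, neg_count x)" for x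
  have lt: "card {u \<in> P. u \<bullet> u < y \<bullet> y} < card {u \<in> P. u \<bullet> u < x \<bullet> x}"
    if "y \<in> P" "y \<bullet> y < x \<bullet> x" for x y
    using that by (intro psubset_card_mono finite_weights_ball) force
  have "(y, x) \<in> inv_image (less_than <*lex*> less_than) \<mu>" if "(y, x) \<in> prec" for x y
  proof (cases "y \<bullet> y < x \<bullet> x")
    case True
    then show ?thesis
      using lt[of y x] that by (simp add: prec_def \<mu>_def)
  next
    case False
    then show ?thesis
      using that by (simp add: prec_def \<mu>_def)
  qed
  then have "prec \<subseteq> inv_image (less_than <*lex*> less_than) \<mu>"
    by auto
  then show ?thesis
    by (meson wf_inv_image wf_less_than wf_lex_prod wf_subset)
qed

section \<open>The operators on \<open>C(P)\<close>\<close>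

text \<open>Both signs are brought to sums over the string
  \<open>x - of_int k *\<^sub>R \<alpha>\<close>; the case \<open>m = 0\<close> becomes an empty
  sum.\<close>

lemma Jop_eq:
  assumes "x \<in> P" "x \<bullet> coroot \<alpha> = of_int m"
  shows "Jop R \<alpha> f x = (if m \<ge> 0 then - (\<Sum>k\<in>{1..m}. f (x - of_int k *\<^sub>R \<alpha>))
    else (\<Sum>k\<in>{m+1..0}. f (x - of_int k *\<^sub>R \<alpha>)))"
proof -
  have "(\<Sum>k\<in>{0..-m-1}. f (x + of_int k *\<^sub>R \<alpha>)) = (\<Sum>k\<in>{m+1..0}. f (x - of_int k *\<^sub>R \<alpha>))"
    by (rule sum.reindex_bij_witness[of _ uminus uminus]) auto
  then show ?thesis
    using assms by (simp add: Jop_def)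
qed

lemma Jop_cong:
  assumes "\<And>y. y \<in> P \<Longrightarrow> f y = g y" "\<alpha> \<in> R"
  shows "Jop R \<alpha> f x = Jop R \<alpha> g x"
proof (cases "x \<in> P")
  case True
  then obtain m where m: "x \<bullet> coroot \<alpha> = of_int m"
    using P_inner_coroot assms(2) by blast
  show ?thesis
    unfolding Jop_eq[OF True m] using assms P_diff_multiple[OF True assms(2)] by simp
qed (simp add: Jop_def)

lemma Jop_linear:
  "Jop R \<alpha> (\<lambda>y. a * f y + b * g y) x = a * Jop R \<alpha> f x + b * Jop R \<alpha> g x"
  by (simp add: Jop_def Let_def sum.distrib sum_distrib_left algebra_simps)

lemma refl_pairing:
  assumes "\<alpha> \<in> R"
  shows "refl \<alpha> x \<bullet> coroot \<alpha> = - (x \<bullet> coroot \<alpha>)"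
proof -
  have "\<alpha> \<noteq> 0"
    using assms zero_notin_R by auto
  then show ?thesis
    by (simp add: refl_def inner_diff_left inner_coroot_self)
qed

text \<open>The sums at \<open>x\<close> and at \<open>refl \<alpha> x\<close> run over the same
  points of the string, with opposite signs.\<close>

lemma Jop_refl:
  assumes "x \<in> P" "\<alpha> \<in> R"
  shows "Jop R \<alpha> f (refl \<alpha> x) = - Jop R \<alpha> f x"
proof -
  have *: "Jop R \<alpha> f (refl \<alpha> y) = - Jop R \<alpha> f y"
    if y: "y \<in> P" "y \<bullet> coroot \<alpha> = of_int m" "m \<ge> 0" for y m
  proof -
    have "refl \<alpha> y \<bullet> coroot \<alpha> = of_int (- m)"
      using refl_pairing[OF assms(2)] y by simp
    note J = Jop_eq[OF refl_in_P[OF y(1) assms(2)] this]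
    have "(\<Sum>k\<in>{- m + 1..0}. f (refl \<alpha> y - of_int k *\<^sub>R \<alpha>)) = (\<Sum>k\<in>{1..m}. f (y - of_int k *\<^sub>R \<alpha>))"
      by (rule sum.reindex_bij_witness[of _ "\<lambda>k. k - m" "\<lambda>k. k + m"])
        (auto simp: refl_def y(2) algebra_simps)
    then show ?thesis
      unfolding J Jop_eq[OF y(1,2)] using y(3) by auto
  qed
  obtain m where m: "x \<bullet> coroot \<alpha> = of_int m"
    using P_inner_coroot assms by blast
  show ?thesis
  proof (cases "m \<ge> 0")
    case True
    then show ?thesis
      using * assms(1) m by blast
  next
    case False
    then show ?thesis
      using *[OF refl_in_P[OF assms], of "- m"] refl_pairing[OF assms(2)] m by simp
  qed
qed

text \<open>The reflection reverses the string from \<open>x\<close> to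
  \<open>refl \<alpha> x\<close>. \<open>Jop\<close> sums over all of it but one end, and the
  reversal changes which end is left out, so the two sides differ by the end values.\<close>

lemma Jop_comp_refl:
  assumes "x \<in> P" "\<alpha> \<in> R"
  shows "Jop R \<alpha> (\<lambda>y. f (refl \<alpha> y)) x = f (refl \<alpha> x) - f x + Jop R \<alpha> f x"
proof -
  obtain m where m: "x \<bullet> coroot \<alpha> = of_int m"
    using P_inner_coroot assms by blast
  define g where "g k = f (x - of_int k *\<^sub>R \<alpha>)" for k :: int
  have "\<alpha> \<noteq> 0"
    using assms(2) zero_notin_R by auto
  then have g_refl: "f (refl \<alpha> (x - of_int k *\<^sub>R \<alpha>)) = g (m - k)" for k
    by (simp add: g_def refl_def inner_diff_left inner_coroot_self m diff_diff_eq
        flip: scaleR_add_left)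
  have g_ends: "f (refl \<alpha> x) = g m" "f x = g 0"
    by (simp_all add: g_def refl_def m)
  show ?thesis
  proof (cases "m \<ge> 0")
    case True
    have "(\<Sum>k\<in>{1..m}. g (m - k)) = (\<Sum>k\<in>{0..m-1}. g k)"
      by (rule sum.reindex_bij_witness[of _ "\<lambda>k. m - k" "\<lambda>k. m - k"]) auto
    moreover have "g m + sum g {0..m-1} = g 0 + sum g {1..m}"
      using sum_int_last[OF True, of g] sum_int_first[OF True, of g] by simp
    ultimately show ?thesis
      unfolding Jop_eq[OF assms(1) m] g_refl g_ends using True
      by (simp add: algebra_simps flip: g_def)
  next
    case False
    have "(\<Sum>k\<in>{m+1..0}. g (m - k)) = (\<Sum>k\<in>{m..-1}. g k)"
      by (rule sum.reindex_bij_witness[of _ "\<lambda>k. m - k" "\<lambda>k. m - k"]) auto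
    moreover have "g 0 + sum g {m..-1} = g m + sum g {m+1..0}"
      using sum_int_last[of m 0 g] sum_int_first[of m 0 g] False by simp
    ultimately show ?thesis
      unfolding Jop_eq[OF assms(1) m] g_refl g_ends using False
      by (simp add: algebra_simps flip: g_def)
  qed
qed

text \<open>With \<open>J = Jop R \<alpha>\<close>, antisymmetry turns \<open>J (J f)\<close>
  composed with the reflection inside into \<open>- J (J f)\<close>, and
  \<open>Jop_comp_refl\<close> evaluates the same expression as
  \<open>J (J f) - 2 * J f\<close>.\<close>

lemma Jop_idem:
  assumes "x \<in> P" "\<alpha> \<in> R"
  shows "Jop R \<alpha> (Jop R \<alpha> f) x = Jop R \<alpha> f x"
proof -
  let ?J = "Jop R \<alpha>"
  have "- ?J (?J f) x = ?J (\<lambda>y. (-1) * ?J f y + 0 * ?J f y) x"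
    unfolding Jop_linear by simp
  also have "\<dots> = ?J (\<lambda>y. ?J f (refl \<alpha> y)) x"
    by (rule Jop_cong[OF _ assms(2)]) (simp add: Jop_refl assms(2))
  also have "\<dots> = - ?J f x - ?J f x + ?J (?J f) x"
    by (simp add: Jop_comp_refl[OF assms] Jop_refl[OF assms])
  finally show ?thesis
    by (simp add: algebra_simps)
qed

end

section \<open>The operators \<open>I \<alpha>\<close> and their inverses\<close>

locale hecke_parameters = based_root_system R z for R :: "'a::euclidean_space set" and z +
  fixes q :: "('a \<Rightarrow> 'a) \<Rightarrow> real"
  assumes length_mult: "length_mult R z q"
begin

abbreviation "I \<equiv> Iop R q"

lemma q_nonzero: "w \<in> W0 R \<Longrightarrow> q w \<noteq> 0" "x \<in> P \<Longrightarrow> q (transl x) \<noteq> 0"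
proof -
  have nz: "q (transl x \<circ> w) \<noteq> 0" if "w \<in> W0 R" "x \<in> P" for x w
    using length_mult that unfolding length_mult_def Waff_def by blast
  have "transl 0 \<circ> w = w" for w :: "'a \<Rightarrow> 'a"
    by (simp add: transl_def comp_def)
  moreover have "0 \<in> P"
    by (simp add: weights_def)
  ultimately show "w \<in> W0 R \<Longrightarrow> q w \<noteq> 0"
    using nz by metis
  show "x \<in> P \<Longrightarrow> q (transl x) \<noteq> 0"
    using nz[OF W0_id] by simp
qed

lemma q_refl_nonzero: "\<alpha> \<in> R \<Longrightarrow> q (refl \<alpha>) \<noteq> 0"
  using q_nonzero(1)[OF refl_word_in_W0[of "[\<alpha>]"]] by simp

definition dq :: "'a \<Rightarrow> complex" where
  "dq \<alpha> = complex_of_real (q (refl \<alpha>) - 1 / q (refl \<alpha>))"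

lemma Iop_eq:
  "x \<in> P \<Longrightarrow> I \<alpha> f x = complex_of_real (q (refl \<alpha>)) * f (refl \<alpha> x) + dq \<alpha> * Jop R \<alpha> f x"
  by (simp add: Iop_def dq_def)

lemma Iop_linear: "I \<alpha> (\<lambda>y. a * f y + b * g y) = (\<lambda>x. a * I \<alpha> f x + b * I \<alpha> g x)"
  by (auto simp: fun_eq_iff Iop_def Jop_linear algebra_simps)

lemma Iop_in_CP: "I \<alpha> f \<in> CP R"
  by (simp add: CP_def Iop_def)

text \<open>The Hecke relation solved for the square. After \<open>Jop_refl\<close>,
  \<open>Jop_comp_refl\<close> and \<open>Jop_idem\<close> only the scalar identity
  \<open>?q * ?q - dq \<alpha> * ?q = 1\<close> remains.\<close>

lemma Iop_quadratic:
  assumes "f \<in> CP R" "\<alpha> \<in> R"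
  shows "I \<alpha> (I \<alpha> f) x = dq \<alpha> * I \<alpha> f x + f x"
proof (cases "x \<in> P")
  case True
  let ?J = "Jop R \<alpha>" and ?q = "complex_of_real (q (refl \<alpha>))" and ?s = "\<lambda>y. f (refl \<alpha> y)"
  have "?J (I \<alpha> f) x = ?J (\<lambda>y. ?q * ?s y + dq \<alpha> * ?J f y) x"
    by (rule Jop_cong[OF _ assms(2)]) (simp add: Iop_eq)
  also have "\<dots> = ?q * (f (refl \<alpha> x) - f x + ?J f x) + dq \<alpha> * ?J f x"
    unfolding Jop_linear by (simp add: Jop_comp_refl Jop_idem True assms(2))
  finally have "I \<alpha> (I \<alpha> f) x = ?q * (?q * f x + dq \<alpha> * - ?J f x)
      + dq \<alpha> * (?q * (f (refl \<alpha> x) - f x + ?J f x) + dq \<alpha> * ?J f x)"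
    using True assms(2) by (simp add: Iop_eq refl_in_P Jop_refl)
  moreover have "?q * ?q - dq \<alpha> * ?q = 1"
    using q_refl_nonzero[OF assms(2)] by (simp add: dq_def algebra_simps)
  ultimately show ?thesis
    using True by (simp add: Iop_eq) algebra
qed (use assms(1) in \<open>simp add: Iop_def CP_def\<close>)

text \<open>The factor \<open>1\<close> gives the right-hand side the shape to which \<open>Iop_linear\<close> applies.\<close>

definition K :: "'a \<Rightarrow> ('a \<Rightarrow> complex) \<Rightarrow> 'a \<Rightarrow> complex" where
  "K \<alpha> f = (\<lambda>x. 1 * I \<alpha> f x + (- dq \<alpha>) * f x)"

lemma K_in_CP: "f \<in> CP R \<Longrightarrow> K \<alpha> f \<in> CP R"
  using Iop_in_CP by (simp add: K_def CP_def)

lemma K_linear: "K \<alpha> (\<lambda>y. a * f y + b * g y) = (\<lambda>x. a * K \<alpha> f x + b * K \<alpha> g x)"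
  unfolding K_def Iop_linear by (simp add: fun_eq_iff algebra_simps)

text \<open>The quadratic relation says that \<open>I \<alpha>\<close> times
  (\<open>I \<alpha>\<close> minus \<open>dq \<alpha>\<close>) is the identity on
  \<open>CP R\<close>, in either order.\<close>

lemma
  assumes "f \<in> CP R" "\<alpha> \<in> R"
  shows Iop_K: "I \<alpha> (K \<alpha> f) = f" and K_Iop: "K \<alpha> (I \<alpha> f) = f"
  unfolding K_def Iop_linear using Iop_quadratic[OF assms] by (auto simp: fun_eq_iff)

abbreviation Iword :: "'a list \<Rightarrow> ('a \<Rightarrow> complex) \<Rightarrow> 'a \<Rightarrow> complex" where
  "Iword js \<equiv> foldr (\<circ>) (map I js) id"

lemma fold_K_in_CP: "f \<in> CP R \<Longrightarrow> fold K js f \<in> CP R"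
  by (induction js arbitrary: f) (auto intro: K_in_CP)

lemma Iword_in_CP: "f \<in> CP R \<Longrightarrow> Iword js f \<in> CP R"
  by (cases js) (auto intro: Iop_in_CP)

lemma fold_K_linear:
  "fold K js (\<lambda>y. a * f y + b * g y) = (\<lambda>x. a * fold K js f x + b * fold K js g x)"
  by (induction js arbitrary: f g) (simp_all add: K_linear)

text \<open>\<open>Iword\<close> applies the operator of the head last, so the inverse has to undo
  the head first, which is the order of \<open>fold\<close>.\<close>

lemma Iword_fold_K: "f \<in> CP R \<Longrightarrow> set js \<subseteq> R \<Longrightarrow> Iword js (fold K js f) = f"
  by (induction js arbitrary: f) (auto simp: K_in_CP Iop_K)

lemma fold_K_Iword: "f \<in> CP R \<Longrightarrow> set js \<subseteq> R \<Longrightarrow> fold K js (Iword js f) = f"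
  by (induction js arbitrary: f) (auto simp: Iword_in_CP K_Iop)

lemma inv_into_Iword:
  assumes "f \<in> CP R" "set js \<subseteq> R"
  shows "inv_into (CP R) (Iword js) f = fold K js f"
proof (rule inv_into_f_eq)
  show "inj_on (Iword js) (CP R)"
    using assms(2) by (intro inj_on_inverseI[where g = "fold K js"]) (simp add: fold_K_Iword)
qed (use assms in \<open>simp_all add: fold_K_in_CP Iword_fold_K\<close>)

section \<open>Expansion of the inverses along root strings\<close>

lemma K_eq:
  assumes "x \<in> P" "x \<bullet> coroot \<alpha> = of_int m"
  shows "K \<alpha> g x = complex_of_real (q (refl \<alpha>)) * g (x - of_int m *\<^sub>R \<alpha>)
    + dq \<alpha> * (if m \<ge> 0 then - (\<Sum>k\<in>{1..m}. g (x - of_int k *\<^sub>R \<alpha>))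
        else (\<Sum>k\<in>{m+1..0}. g (x - of_int k *\<^sub>R \<alpha>))) - dq \<alpha> * g (x - of_int 0 *\<^sub>R \<alpha>)"
  using assms by (simp add: K_def Iop_eq Jop_eq refl_def)

lemma K_eq_0:
  assumes "x \<in> P" "x \<bullet> coroot \<alpha> = of_int m"
    and "\<And>k. 0 \<le> k \<and> k \<le> m \<or> m \<le> k \<and> k \<le> 0 \<Longrightarrow> g (x - of_int k *\<^sub>R \<alpha>) = 0"
  shows "K \<alpha> g x = 0"
proof -
  have "(\<Sum>k\<in>{1..m}. g (x - of_int k *\<^sub>R \<alpha>)) = 0"
    "(\<Sum>k\<in>{m+1..0}. g (x - of_int k *\<^sub>R \<alpha>)) = 0"
    by (rule sum.neutral; simp add: assms(3))+
  then show ?thesis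
    unfolding K_eq[OF assms(1,2)] using assms(3)[of m] assms(3)[of 0] by simp
qed

text \<open>For positive \<open>m\<close> the reflected point is the term \<open>k = m\<close> of
  the \<open>Jop\<close> sum, so its full coefficient is \<open>q (refl \<alpha>)\<close> minus
  \<open>dq \<alpha>\<close>, the nonzero number \<open>1 / q (refl \<alpha>)\<close>.\<close>

lemma K_eq_lead:
  assumes "x \<in> P" "\<alpha> \<in> R" "x \<bullet> coroot \<alpha> = of_int m" "m > 0"
    and "\<And>k. 0 \<le> k \<Longrightarrow> k < m \<Longrightarrow> g (x - of_int k *\<^sub>R \<alpha>) = 0"
  shows "K \<alpha> g x = complex_of_real (1 / q (refl \<alpha>)) * g (refl \<alpha> x)"
proof -
  have "(\<Sum>k\<in>{1..m}. g (x - of_int k *\<^sub>R \<alpha>)) = g (x - of_int m *\<^sub>R \<alpha>)"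
    using assms(4,5) sum_int_last[of 1 m "\<lambda>k. g (x - of_int k *\<^sub>R \<alpha>)"] by simp
  then have "K \<alpha> g x = (complex_of_real (q (refl \<alpha>)) - dq \<alpha>) * g (x - of_int m *\<^sub>R \<alpha>)"
    unfolding K_eq[OF assms(1,3)] using assms(4) assms(5)[of 0] by (simp add: algebra_simps)
  then show ?thesis
    by (simp add: dq_def refl_def assms(3))
qed

lemma inner_string:
  assumes "\<alpha> \<in> R" "x \<bullet> coroot \<alpha> = of_int m"
  shows "(x - of_int k *\<^sub>R \<alpha>) \<bullet> (x - of_int k *\<^sub>R \<alpha>)
    = x \<bullet> x - of_int (k * (m - k)) * (\<alpha> \<bullet> \<alpha>)"
proof -
  have "\<alpha> \<noteq> 0"
    using assms zero_notin_R by auto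
  then have "2 * (x \<bullet> \<alpha>) = of_int m * (\<alpha> \<bullet> \<alpha>)"
    using assms(2) by (simp add: inner_coroot field_simps)
  then show ?thesis
    by (simp add: inner_diff_left inner_diff_right inner_commute algebra_simps)
qed

text \<open>The ends \<open>x\<close> and \<open>refl \<alpha> x\<close> of the string lie on one
  sphere, and the points strictly between them lie inside it.\<close>

lemma inner_string_less:
  assumes "\<alpha> \<in> R" "x \<bullet> coroot \<alpha> = of_int m" "0 < k \<and> k < m \<or> m < k \<and> k < 0"
  shows "(x - of_int k *\<^sub>R \<alpha>) \<bullet> (x - of_int k *\<^sub>R \<alpha>) < x \<bullet> x"
proof -
  have "k * (m - k) > 0"
    using assms(3) by (auto simp: zero_less_mult_iff)
  then have "real_of_int (k * (m - k)) > 0"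
    by (simp only: of_int_0_less_iff)
  moreover have "\<alpha> \<bullet> \<alpha> > 0"
    using assms(1) zero_notin_R by auto
  ultimately show ?thesis
    unfolding inner_string[OF assms(1,2)] by (simp add: mult_pos_pos del: of_int_mult)
qed

text \<open>The last letter is the outermost operator and reads the string from \<open>x\<close> to
  \<open>refl \<alpha> x\<close>. Each letter thus reaches only shorter weights, or weights of equal
  norm with \<open>neg_count\<close> raised by at most one.\<close>

lemma fold_K_eq_0:
  assumes "set js \<subseteq> Sim" "x \<in> P" "h \<in> CP R"
    and "\<And>y. y \<in> P \<Longrightarrow> y \<bullet> y < x \<bullet> x \<or> y \<bullet> y = x \<bullet> x \<and> neg_count y \<le> neg_count x + length js
      \<Longrightarrow> h y = 0"
  shows "fold K js h x = 0"
  using assms(1,2,4)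
proof (induction js arbitrary: x rule: rev_induct)
  case (snoc \<alpha> js)
  then have \<alpha>: "\<alpha> \<in> Sim" "\<alpha> \<in> R"
    using Sim_in_R by auto
  obtain m where m: "x \<bullet> coroot \<alpha> = of_int m"
    using P_inner_coroot snoc.prems(2) \<alpha>(2) by blast
  have "fold K js h (x - of_int k *\<^sub>R \<alpha>) = 0"
    if k: "0 \<le> k \<and> k \<le> m \<or> m \<le> k \<and> k \<le> 0" for k
  proof (rule snoc.IH)
    let ?x' = "x - of_int k *\<^sub>R \<alpha>"
    show "set js \<subseteq> Sim" "?x' \<in> P"
      using snoc.prems P_diff_multiple \<alpha> by auto
    consider "?x' \<bullet> ?x' < x \<bullet> x" | "?x' = x" | "?x' = refl \<alpha> x"
      using inner_string_less[OF \<alpha>(2) m, of k] k by (force simp: refl_def m)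
    then have "?x' \<bullet> ?x' < x \<bullet> x \<or> ?x' \<bullet> ?x' = x \<bullet> x \<and> neg_count ?x' \<le> Suc (neg_count x)"
    proof cases
      case 2
      then show ?thesis
        unfolding 2 by simp
    next
      case 3
      then show ?thesis
        unfolding 3 using neg_count_refl_le[OF \<alpha>(1)] by (simp add: refl_inner_self)
    qed simp
    then show "h y = 0" if "y \<in> P"
      "y \<bullet> y < ?x' \<bullet> ?x' \<or> y \<bullet> y = ?x' \<bullet> ?x' \<and> neg_count y \<le> neg_count ?x' + length js" for y
      using that snoc.prems(3)[of y] by fastforce
  qed
  then show ?case
    using K_eq_0[OF snoc.prems(2) m] by simp
qed simp

text \<open>The third assumption makes every letter move away from the dominant chamber, so
  \<open>K_eq_lead\<close> applies each time. Only the reflected end of the string survives, and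
  \<open>c\<close> collects the factors \<open>1 / q (refl \<alpha>)\<close>.\<close>

lemma fold_K_triangular:
  assumes "set js \<subseteq> Sim" "x \<in> P" "neg_count (refl_word js x) = neg_count x + length js"
  shows "\<exists>c\<noteq>0. \<forall>h\<in>CP R.
    (\<forall>y\<in>P. y \<bullet> y < x \<bullet> x \<or> y \<bullet> y = x \<bullet> x \<and> neg_count y < neg_count x + length js \<longrightarrow> h y = 0)
      \<longrightarrow> fold K js h x = c * h (refl_word js x)"
  using assms
proof (induction js arbitrary: x rule: rev_induct)
  case Nil
  then show ?case
    by (intro exI[of _ 1]) simp
next
  case (snoc \<alpha> js)
  then have \<alpha>: "\<alpha> \<in> Sim" "\<alpha> \<in> R" and js: "set js \<subseteq> Sim"
    using Sim_in_R by auto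
  have n: "neg_count (refl_word js (refl \<alpha> x)) = Suc (neg_count x) + length js"
    using snoc.prems(3) by simp
  \<comment> \<open>The growth is at most one per letter, so the maximal total forces this letter to
    contribute one.\<close>
  then have n': "neg_count (refl \<alpha> x) = Suc (neg_count x)"
    using neg_count_refl_word_le[OF js, of "refl \<alpha> x"] neg_count_refl_le[OF \<alpha>(1), of x] by simp
  have "\<not> x \<bullet> \<alpha> < 0"
    using neg_count_refl_neg[OF \<alpha>(1), of x] n' by auto
  moreover have "x \<bullet> \<alpha> \<noteq> 0"
    using n' by (auto simp: refl_def inner_coroot)
  ultimately have "x \<bullet> \<alpha> > 0"
    by simp
  obtain m where m: "x \<bullet> coroot \<alpha> = of_int m"
    using P_inner_coroot snoc.prems(2) \<alpha>(2) by blast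
  have "\<alpha> \<noteq> 0"
    using \<open>x \<bullet> \<alpha> > 0\<close> by auto
  then have "x \<bullet> coroot \<alpha> > 0"
    using \<open>x \<bullet> \<alpha> > 0\<close> by (simp add: coroot_pos_iff)
  then have "m > 0"
    using m by simp
  obtain c where c: "c \<noteq> 0" and IH: "\<And>h. h \<in> CP R \<Longrightarrow>
    (\<forall>y\<in>P. y \<bullet> y < x \<bullet> x \<or> y \<bullet> y = x \<bullet> x \<and> neg_count y < Suc (neg_count x) + length js \<longrightarrow> h y = 0)
      \<Longrightarrow> fold K js h (refl \<alpha> x) = c * h (refl_word js (refl \<alpha> x))"
    using snoc.IH[OF js refl_in_P[OF snoc.prems(2) \<alpha>(2)], unfolded n' refl_inner_self, OF n] by blast
  have "fold K (js @ [\<alpha>]) h x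
      = complex_of_real (1 / q (refl \<alpha>)) * c * h (refl_word (js @ [\<alpha>]) x)"
    if h: "h \<in> CP R" "\<forall>y\<in>P. y \<bullet> y < x \<bullet> x
      \<or> y \<bullet> y = x \<bullet> x \<and> neg_count y < neg_count x + length (js @ [\<alpha>]) \<longrightarrow> h y = 0" for h
  proof -
    have "fold K js h (x - of_int k *\<^sub>R \<alpha>) = 0" if k: "0 \<le> k" "k < m" for k
    proof (rule fold_K_eq_0[OF js P_diff_multiple[OF snoc.prems(2) \<alpha>(2)] h(1)])
      fix y assume y: "y \<in> P" "y \<bullet> y < (x - of_int k *\<^sub>R \<alpha>) \<bullet> (x - of_int k *\<^sub>R \<alpha>)
        \<or> y \<bullet> y = (x - of_int k *\<^sub>R \<alpha>) \<bullet> (x - of_int k *\<^sub>R \<alpha>)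
          \<and> neg_count y \<le> neg_count (x - of_int k *\<^sub>R \<alpha>) + length js"
      show "h y = 0"
      \<comment> \<open>At \<open>x\<close> itself one letter fewer is left, which keeps
        \<open>neg_count\<close> strictly below the bound; the other points are strictly shorter
        than \<open>x\<close>.\<close>
      proof (cases "k = 0")
        case True
        then show ?thesis
          using y h(2) by auto
      next
        case False
        then show ?thesis
          using y h(2) inner_string_less[OF \<alpha>(2) m, of k] k by fastforce
      qed
    qed
    then have "K \<alpha> (fold K js h) x
        = complex_of_real (1 / q (refl \<alpha>)) * fold K js h (refl \<alpha> x)"
      using K_eq_lead[OF snoc.prems(2) \<alpha>(2) m \<open>m > 0\<close>] by blast
    then show ?thesis
      using IH[OF h(1)] h(2) by simp
  qed
  moreover have "complex_of_real (1 / q (refl \<alpha>)) * c \<noteq> 0"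
    using c q_refl_nonzero[OF \<alpha>(2)] by simp
  ultimately show ?case
    by (intro exI[of _ "complex_of_real (1 / q (refl \<alpha>)) * c"]) simp
qed

section \<open>Triangularity of \<open>Jcal\<close>\<close>

lemma Jcal_eq:
  assumes "x \<in> P"
  obtains js where "set js \<subseteq> Sim" "length js = neg_count x" "refl_word js (wmin R z x x) = x"
    "\<And>f. f \<in> CP R \<Longrightarrow> Jcal R z q f x
      = complex_of_real (q (transl x) * q (wmin R z x)) * fold K js f (wmin R z x x)"
proof -
  let ?w = "wmin R z x"
  \<comment> \<open>The word chosen inside \<open>IT\<close>. It depends on \<open>x\<close> but not
    on \<open>f\<close>, which is what makes \<open>Jcal\<close> linear.\<close>
  define js where "js = (SOME js. reduced_word R z (inv ?w) js)"
  have W: "?w \<in> W0 R" "inv ?w \<in> W0 R"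
    using wmin[OF assms] W0_inv by auto
  have "reduced_word R z (inv ?w) js"
    unfolding js_def using reduced_word_exists[OF W(2)] by (metis someI)
  then have js: "set js \<subseteq> Sim" "inv ?w = refl_word js" "length js = len R z (inv ?w)"
    by (auto simp: reduced_word_def refl_word_def)
  have "length js = neg_count x"
    using js(3) wmin(3)[OF assms] W by (simp add: len_eq_card_inversions card_inversions_inv)
  moreover have "refl_word js (?w x) = x"
    using W0_eq_refl_word[OF W(1)] by (metis inv_refl_word js(2) refl_word_rev)
  moreover have "Jcal R z q f x
      = complex_of_real (q (transl x) * q ?w) * fold K js f (?w x)" if "f \<in> CP R" for f
    using assms inv_into_Iword[OF that Sim_set_in_R[OF js(1)]]
    by (simp add: Jcal_def Let_def IT_def flip: js_def)
  ultimately show ?thesis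
    using that js(1) by blast
qed

lemma Jcal_linear:
  assumes "f \<in> CP R" "g \<in> CP R"
  shows "Jcal R z q (\<lambda>x. a * f x + b * g x) = (\<lambda>x. a * Jcal R z q f x + b * Jcal R z q g x)"
proof
  fix x
  show "Jcal R z q (\<lambda>x. a * f x + b * g x) x = a * Jcal R z q f x + b * Jcal R z q g x"
  proof (cases "x \<in> P")
    case True
    then obtain js where "\<And>f. f \<in> CP R \<Longrightarrow> Jcal R z q f x
      = complex_of_real (q (transl x) * q (wmin R z x)) * fold K js f (wmin R z x x)"
      using Jcal_eq by metis
    moreover have "(\<lambda>x. a * f x + b * g x) \<in> CP R"
      using assms by (simp add: CP_def)
    ultimately show ?thesis
      using assms by (simp add: fold_K_linear algebra_simps)
  qed (simp add: Jcal_def)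
qed

text \<open>The word starts at the dominant weight, where \<open>neg_count\<close> is 0, and has
  \<open>neg_count x\<close> letters ending at \<open>x\<close>. So \<open>fold_K_triangular\<close>
  applies, and its condition on \<open>h\<close> is vanishing below \<open>x\<close> for
  \<open>prec\<close>.\<close>

lemma Jcal_triangular:
  assumes "x \<in> P"
  shows "\<exists>c\<noteq>0. \<forall>h\<in>CP R. (\<forall>y\<in>P. (y, x) \<in> prec \<longrightarrow> h y = 0) \<longrightarrow> Jcal R z q h x = c * h x"
proof -
  let ?w = "wmin R z x"
  obtain js where js: "set js \<subseteq> Sim" "length js = neg_count x" "refl_word js (?w x) = x"
    and J: "\<And>f. f \<in> CP R \<Longrightarrow> Jcal R z q f x
      = complex_of_real (q (transl x) * q ?w) * fold K js f (?w x)"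
    using Jcal_eq[OF assms] by metis
  have dom: "?w x \<in> P" "neg_count (?w x) = 0"
    using wmin(2)[OF assms] by (auto simp: dominant_iff)
  have "?w x \<bullet> ?w x = x \<bullet> x"
    using orthogonal_transformation_refl_word[of js] js(3)
    by (metis orthogonal_transformation_def)
  then obtain c where c: "c \<noteq> 0" "\<And>h. h \<in> CP R \<Longrightarrow>
      (\<forall>y\<in>P. y \<bullet> y < x \<bullet> x \<or> y \<bullet> y = x \<bullet> x \<and> neg_count y < neg_count x \<longrightarrow> h y = 0)
        \<Longrightarrow> fold K js h (?w x) = c * h x"
    using fold_K_triangular[OF js(1) dom(1)] js dom by auto
  have "complex_of_real (q (transl x) * q ?w) * c \<noteq> 0"
    using c(1) q_nonzero wmin(1)[OF assms] assms by simp
  moreover have "Jcal R z q h x = complex_of_real (q (transl x) * q ?w) * c * h x"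
    if "h \<in> CP R" "\<forall>y\<in>P. (y, x) \<in> prec \<longrightarrow> h y = 0" for h
    using J c(2) that assms by (simp add: prec_def)
  ultimately show ?thesis
    by blast
qed

lemma bij_betw_Jcal: "bij_betw (Jcal R z q) (CP R) (CP R)"
proof -
  \<comment> \<open>The diagonal entry depends on \<open>x\<close> only, not on \<open>h\<close>, so
    it can be chosen as a function of \<open>x\<close>.\<close>
  obtain c where c: "\<And>x. x \<in> P \<Longrightarrow> c x \<noteq> 0" "\<And>x h. x \<in> P \<Longrightarrow> h \<in> CP R \<Longrightarrow>
      (\<And>y. y \<in> P \<Longrightarrow> (y, x) \<in> prec \<Longrightarrow> h y = 0) \<Longrightarrow> Jcal R z q h x = c x * h x"
    using Jcal_triangular by metis
  show ?thesis
  proof (rule bij_betw_triangular[OF wf_prec, where P = P and F = "Jcal R z q",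
        folded CP_def])
    show "Jcal R z q f \<in> CP R" for f
      by (simp add: CP_def Jcal_def)
  qed (fact Jcal_linear c)+
qed

end

theorem mainTheorem9:
  fixes R :: "'a::euclidean_space set" and z :: 'a and q :: "('a \<Rightarrow> 'a) \<Rightarrow> real"
  assumes "root_system R" and "reduced_rs R" and "irreducible_rs R"
    and "regular R z" and "length_mult R z q"
  shows "(\<forall>f\<in>CP R. \<forall>g\<in>CP R. \<forall>a b::complex.
            Jcal R z q (\<lambda>x. a * f x + b * g x) = (\<lambda>x. a * Jcal R z q f x + b * Jcal R z q g x))
         \<and> bij_betw (Jcal R z q) (CP R) (CP R)"
proof -
  interpret hecke_parameters R z q
    using assms by unfold_locales
  show ?thesis
    by (simp add: Jcal_linear bij_betw_Jcal)
qed

end
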